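(* Let $r\ge 1$ and $d\ge 1$ be integers. There exist constants $M_1(r,d)$ and $M_2(r,d)$, depending only on $r$ and $d$, and a constant $M$ depending at most on $d$, such that for every $f\in C(I^d)$ and every integer $n\ge 0$ the following hold. (i) For every $i\in\{1,\dots,d\}$, every $t$ with $0\le t\le 2^{-n}$ and every $u$ with $u,\,u+rt e_i\in I^d$, $$\bigl|\Delta^r_{t e_i}f(u)\bigr|\le M_1(r,d)\sum_{k=0}^\infty \Psi_r(f,n+k).$$ (ii) For every $t$ with $2^{-n-1}<t\le 2^{-n}$, $$\omega^r(f,t)\le M_2(r,d)\Bigl(\sum_{k=0}^\infty\Psi_r(f,n+k)+\sum_{k=1}^{n_0}2^{-kr}\,\Psi_r(f,n-k)+t^r\|f\|\Bigr),$$ where $n_0$ is the largest integer satisfying $r\,2^{n_0-n-1}\le 1$ (the second sum being empty if $n_0<1$). (iii) In the case $r=1$, for every $t$ with $0\le t\le 2^{-n}$, $$\omega^1(f,t)\le M\sum_{k=0}^\infty\Psi_1(f,n+k).$$ (The right-hand sides are allowed to be $+\infty$, in which case the inequality is vacuous.)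
   Context: $I^d=[0,1]^d$; $C(I^d)$ is the space of continuous real-valued functions on $I^d$ with $\|f\|=\max_{x\in I^d}|f(x)|$; $|h|$ is the Euclidean norm of $h\in\mathbb{R}^d$; $e_i$ is the unit vector in the $i$-th coordinate direction of $\mathbb{R}^d$. For $h\in\mathbb{R}^d$ with $x,x+rh\in I^d$, $\Delta^r_h f(x)=\sum_{k=0}^r(-1)^{r-k}\binom{r}{k}f(x+kh)$. The $r$-th modulus of smoothness is $\omega^r(f,t)=\sup\{|\Delta^r_h f(x)| : |h|\le t,\ x,\,x+rh\in I^d\}$. The discrete $r$-th modulus of smoothness is defined for every integer $m$ by $$\Psi_r(f,m)=\sup\bigl\{|\Delta^r_{2^{-m}e_i}f(2^{-m}\kappa)| : 1\le i\le d,\ \kappa\in\mathbb{Z}^d,\ 2^{-m}\kappa\in I^d,\ 2^{-m}(\kappa+re_i)\in I^d\bigr\},$$ with the convention that the supremum of the empty set is $0$. *)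

theory Defs
  imports "HOL-Analysis.Analysis"
begin

definition unit_cube :: "(real ^ 'n) set" where
  "unit_cube = cbox 0 1"

definition finite_diff :: "nat \<Rightarrow> real ^ 'n \<Rightarrow> (real ^ 'n \<Rightarrow> real) \<Rightarrow> real ^ 'n \<Rightarrow> real" where
  "finite_diff r h f x =
     (\<Sum>k\<le>r. (-1) ^ (r - k) * real (r choose k) * f (x + real k *\<^sub>R h))"

text \<open>
  All suprema are taken in \<^typ>\<open>ennreal\<close>. There they always exist, the supremum of the empty
  set is 0, and an infinite sum of moduli is either finite or equal to infinity.
\<close>

definition cube_norm :: "(real ^ 'n \<Rightarrow> real) \<Rightarrow> ennreal" where
  "cube_norm f = (SUP x\<in>unit_cube. ennreal \<bar>f x\<bar>)"

definition modulus_smoothness :: "nat \<Rightarrow> (real ^ 'n \<Rightarrow> real) \<Rightarrow> real \<Rightarrow> ennreal" where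
  "modulus_smoothness r f t =
     Sup {ennreal \<bar>finite_diff r h f x\<bar> | h x.
            norm h \<le> t \<and> x \<in> unit_cube \<and> x + real r *\<^sub>R h \<in> unit_cube}"

definition int_vec :: "int ^ 'n \<Rightarrow> real ^ 'n" where
  "int_vec \<kappa> = (\<chi> j. real_of_int (\<kappa> $ j))"

definition discrete_modulus :: "nat \<Rightarrow> (real ^ 'n \<Rightarrow> real) \<Rightarrow> int \<Rightarrow> ennreal" where
  "discrete_modulus r f m =
     Sup {ennreal \<bar>finite_diff r (2 powi (- m) *\<^sub>R axis i 1) f (2 powi (- m) *\<^sub>R int_vec \<kappa>)\<bar> | i \<kappa>.
            2 powi (- m) *\<^sub>R int_vec \<kappa> \<in> unit_cube \<and>
            2 powi (- m) *\<^sub>R (int_vec \<kappa> + real r *\<^sub>R axis i 1) \<in> unit_cube}"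

text \<open>For \<open>r \<ge> 1\<close> the greatest such integer exists; it may be negative, and for \<open>r = 1\<close> it is
  \<open>n + 1\<close>.\<close>

definition level_cutoff :: "nat \<Rightarrow> nat \<Rightarrow> int" where
  "level_cutoff r n = (GREATEST j::int. real r * 2 powi (j - int n - 1) \<le> 1)"

end

theory Submission
  imports Defs "HOL-Computational_Algebra.Polynomial"
begin

text \<open>
  On a dyadic window of fixed side (counted in steps of the grid) let \<open>p\<close> be the tensor product
  Lagrange polynomial of coordinate degree less than \<open>r\<close> through the first \<open>r\<^sup>d\<close> grid points. The
  polynomials of a window and of one of its halves at the next level differ by at most a constant
  times the discrete modulus of that level, because both reproduce the interpolant on the finer
  grid up to such an error; telescoping and continuity bound \<open>f - p\<close> by the sum of the moduli.
  Since pure \<open>r\<close>-th differences annihilate \<open>p\<close>, this gives (i).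

  For (ii), \<open>\<Delta>\<^sub>h\<^sup>r\<close> expands into mixed coordinate differences of total order \<open>r\<close>. Doubling the step
  in each coordinate bounds a mixed difference of order \<open>s\<close> at scale \<open>t\<close> by \<open>2\<^sup>-\<^sup>s\<close> times one at scale
  \<open>2t\<close> plus mixed differences of order \<open>s + 1\<close>. A mixed difference of order \<open>r\<close> in one coordinate is
  bounded by (i), and this must happen once the total order is large, so downward induction on the
  order gives a Marchaud inequality in terms of the sums in (i). For \<open>r = 1\<close> the mixed differences
  are already pure.
\<close>

section \<open>Finite differences\<close>

text \<open>The Marchaud step avoids a logarithmic loss because two contraction rates differ: a
  doubling contracts order \<open>s\<close> by 2^-s, whereas the bound fed in from order
  \<open>s + 1\<close> is a sum that contracts by 2^-(s+1) per level and can be absorbed. At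
  \<open>s = r\<close> the rate 2^-r yields the weights 2^-kr, and the sup norm left over at level 0
  becomes t^r times the norm. What is accumulated on the way are tails of the series of moduli, so a
  geometric sum of tails has to be split into the fine series and the weighted coarse sum.

  The boundary of the cube shapes the rest. Doubling needs room, so it is used only for small steps,
  and the finitely many coarse levels are covered by the sup norm. A window needs more than
  \<open>r\<close> grid steps, so for coarse levels the interpolation starts from a finer one at
  which the whole cube is a single window.

  Functions are total on the space, so identities between difference operators carry no domain
  condition; membership in the cube matters only where values are estimated.\<close>

definition dif :: "'a::real_vector \<Rightarrow> ('a \<Rightarrow> real) \<Rightarrow> 'a \<Rightarrow> real" where
  "dif c g = (\<lambda>x. g (x + c) - g x)"

lemma dif_commute: "dif a \<circ> dif b = dif b \<circ> dif a"
  by (auto simp: dif_def fun_eq_iff algebra_simps)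

lemma funpow_commute:
  assumes "F \<circ> G = G \<circ> F"
  shows "(F ^^ m) \<circ> (G ^^ k) = (G ^^ k) \<circ> (F ^^ m)"
proof -
  have 1: "F \<circ> (G ^^ k) = (G ^^ k) \<circ> F" for k
    by (induction k) (use assms in \<open>auto simp: fun_eq_iff\<close>)
  show ?thesis
    by (induction m) (use 1 in \<open>auto simp: fun_eq_iff\<close>)
qed

lemma dif_funpow_commute: "(dif a ^^ m) ((dif b ^^ k) g) = (dif b ^^ k) ((dif a ^^ m) g)"
  using funpow_commute[OF dif_commute, of m a k b] by (auto simp: fun_eq_iff)

lemma dif_funpow_translate: "(dif a ^^ m) (\<lambda>x. g (x + v)) x = (dif a ^^ m) g (x + v)"
  by (induction m arbitrary: x) (auto simp: dif_def algebra_simps)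

lemma dif_funpow_add: "(dif a ^^ m) (\<lambda>x. g x + k x) x = (dif a ^^ m) g x + (dif a ^^ m) k x"
  by (induction m arbitrary: x) (auto simp: dif_def algebra_simps)

lemma dif_funpow_scale: "(dif a ^^ m) (\<lambda>x. c * g x) x = c * (dif a ^^ m) g x"
  by (induction m arbitrary: x) (auto simp: dif_def algebra_simps)

lemma dif_funpow_Suc: "(dif c ^^ Suc m) g x = (dif c ^^ m) g (x + c) - (dif c ^^ m) g x"
  by (simp add: dif_def)

text \<open>Pascal's rule after an index shift: the translated sum supplies the terms with index
  \<open>Suc k\<close>, and so does the subtracted sum once its term at 0 is split off.\<close>

lemma dif_funpow_sum:
  "(dif c ^^ r) g x = (\<Sum>k\<le>r. (-1) ^ (r - k) * real (r choose k) * g (x + real k *\<^sub>R c))"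
proof (induction r arbitrary: x)
  case 0
  then show ?case by simp
next
  case (Suc r)
  define t where "t k = g (x + real k *\<^sub>R c)" for k
  have shift: "g (x + c + real k *\<^sub>R c) = t (Suc k)" for k
    by (simp add: t_def algebra_simps)
  have sgn: "(-1::real) ^ (Suc r - k) = - ((-1) ^ (r - k))" if "k \<le> r" for k
    using that by (simp add: Suc_diff_le)
  have "(dif c ^^ Suc r) g x =
      (\<Sum>k\<le>r. (-1) ^ (r - k) * real (r choose k) * t (Suc k)) -
      (\<Sum>k\<le>r. (-1) ^ (r - k) * real (r choose k) * t k)"
    unfolding dif_funpow_Suc Suc.IH shift by (simp add: t_def)
  \<comment> \<open>The added term has the coefficient \<open>r choose Suc r\<close>, which is
    0.\<close>
  also have "(\<Sum>k\<le>r. (-1) ^ (r - k) * real (r choose k) * t k) =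
      (\<Sum>k\<le>Suc r. (-1) ^ (r - k) * real (r choose k) * t k)"
    by simp
  also have "\<dots> = (-1) ^ r * t 0
      + (\<Sum>k\<le>r. (-1) ^ (r - Suc k) * real (r choose Suc k) * t (Suc k))"
    by (subst sum.atMost_Suc_shift) simp
  also have "(\<Sum>k\<le>r. (-1) ^ (r - Suc k) * real (r choose Suc k) * t (Suc k))
      = - (\<Sum>k\<le>r. (-1) ^ (r - k) * real (r choose Suc k) * t (Suc k))"
    unfolding sum_negf[symmetric]
  proof (rule sum.cong[OF refl])
    fix k assume "k \<in> {..r}"
    show "(-1) ^ (r - Suc k) * real (r choose Suc k) * t (Suc k)
        = - ((-1) ^ (r - k) * real (r choose Suc k) * t (Suc k))"
    \<comment> \<open>At \<open>k = r\<close> the truncated subtraction spoils the sign, but the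
      binomial coefficient vanishes.\<close>
    proof (cases "k = r")
      case False
      then have "r - k = Suc (r - Suc k)" using \<open>k \<in> {..r}\<close> by auto
      then show ?thesis by simp
    qed simp
  qed
  finally have "(dif c ^^ Suc r) g x =
     (\<Sum>k\<le>r. (-1) ^ (r - k) * real (Suc r choose Suc k) * t (Suc k)) - (-1) ^ r * t 0"
    by (simp add: sum.distrib[symmetric] algebra_simps)
  also have "\<dots> = (\<Sum>k\<le>Suc r. (-1) ^ (Suc r - k) * real (Suc r choose k) * t k)"
    by (simp add: sum.atMost_Suc_shift del: binomial_Suc_Suc sum.atMost_Suc)
  finally show ?case by (simp add: t_def)
qed

lemma finite_diff_eq_dif: "finite_diff r h f x = (dif h ^^ r) f x"
  by (simp add: finite_diff_def dif_funpow_sum)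

lemma dif_funpow_bound:
  assumes "\<And>k. k \<le> r \<Longrightarrow> \<bar>g (x + real k *\<^sub>R c)\<bar> \<le> B"
  shows "\<bar>(dif c ^^ r) g x\<bar> \<le> 2 ^ r * B"
proof -
  have "\<bar>(dif c ^^ r) g x\<bar> \<le> (\<Sum>k\<le>r. \<bar>(-1) ^ (r - k) * real (r choose k) * g (x + real k *\<^sub>R c)\<bar>)"
    unfolding dif_funpow_sum by (rule sum_abs)
  also have "\<dots> \<le> (\<Sum>k\<le>r. real (r choose k) * B)"
    by (intro sum_mono) (use assms in \<open>simp add: abs_mult power_abs mult_left_mono\<close>)
  also have "\<dots> = 2 ^ r * B"
    using choose_row_sum[of r] by (metis of_nat_numeral of_nat_power of_nat_sum sum_distrib_right)
  finally show ?thesis .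
qed

text \<open>Reading the segment from its other end changes the difference only by the sign
  \<open>(-1) ^ r\<close>. This reduces negative steps to positive ones and lets a step be turned
  round when the opposite direction has more room.\<close>

lemma dif_funpow_reverse:
  "\<bar>(dif (- c) ^^ r) g (x + real r *\<^sub>R c)\<bar> = \<bar>(dif c ^^ r) g x\<bar>"
proof -
  have "(dif (- c) ^^ r) g (x + real r *\<^sub>R c) = (-1) ^ r * (dif c ^^ r) g x"
  proof (induction r arbitrary: x)
    case (Suc r)
    have "x + real (Suc r) *\<^sub>R c = (x + c) + real r *\<^sub>R c"
      and "x + real (Suc r) *\<^sub>R c + - c = x + real r *\<^sub>R c"
      by (simp_all add: algebra_simps)
    then show ?case
      unfolding dif_funpow_Suc using Suc.IH[of x] Suc.IH[of "x + c"] by (simp add: algebra_simps)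
  qed simp
  then show ?thesis by (simp add: abs_mult power_abs)
qed

text \<open>With \<open>T\<close> the translation by \<open>c\<close>, this is the operator identity
  \<open>(T - 1)\<^sup>a = 2\<^sup>-\<^sup>a (T\<^sup>2 - 1)\<^sup>a - \<onehalf> \<Sum>\<^sub>l\<^sub><\<^sub>a ((T + 1) / 2)\<^sup>l (T - 1)\<^sup>a\<^sup>+\<^sup>1\<close>.\<close>
lemma dif_funpow_doubling:
  fixes G :: "'a::real_vector \<Rightarrow> real"
  assumes K: "\<And>k. k < a \<Longrightarrow> \<bar>(dif c ^^ Suc a) G (x + real k *\<^sub>R c)\<bar> \<le> K"
  shows "\<bar>(dif c ^^ a) G x\<bar> \<le> \<bar>(dif (2 *\<^sub>R c) ^^ a) G x\<bar> / 2 ^ a + real a / 2 * K"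
proof -
  define A where "A g = (\<lambda>x. (g (x + c) + g x) / 2)" for g :: "'a \<Rightarrow> real"
  have A_dif: "A \<circ> dif c = dif c \<circ> A"
    by (auto simp: A_def dif_def fun_eq_iff field_simps)
  have swap: "(dif c ^^ m) ((A ^^ l) g) = (A ^^ l) ((dif c ^^ m) g)" for m l g
    using funpow_commute[OF A_dif, of l m] by (auto simp: fun_eq_iff)
  \<comment> \<open>With T the translation, T^2 - 1 = 2 (T - 1) A. Since \<open>A\<close> commutes
    with differences, powers of the two factors separate.\<close>
  have double: "dif (2 *\<^sub>R c) g = (\<lambda>x. 2 * dif c (A g) x)" for g
    by (auto simp: A_def dif_def fun_eq_iff field_simps scaleR_2)
  have double_pow: "(dif (2 *\<^sub>R c) ^^ m) g x = 2 ^ m * (dif c ^^ m) ((A ^^ m) g) x" for m g x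
  proof (induction m arbitrary: g)
    case (Suc m)
    have "(dif (2 *\<^sub>R c) ^^ Suc m) g x = (dif (2 *\<^sub>R c) ^^ m) (dif (2 *\<^sub>R c) g) x"
      by (simp add: funpow_swap1)
    also have "\<dots> = 2 * (dif (2 *\<^sub>R c) ^^ m) (dif c (A g)) x"
      unfolding double dif_funpow_scale ..
    also have "\<dots> = 2 ^ Suc m * (dif c ^^ m) ((A ^^ m) (dif c (A g))) x"
      by (simp add: Suc.IH)
    also have "(A ^^ m) (dif c (A g)) = dif c ((A ^^ m) (A g))"
      using swap[of 1 m "A g"] by simp
    finally show ?case by (simp add: funpow_swap1)
  qed simp
  \<comment> \<open>\<open>A ^^ l\<close> averages values of \<open>g\<close> at x, x + c, ..., x +
    l c, so it preserves a common bound on them.\<close>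
  have A_bound: "\<bar>(A ^^ l) g x\<bar> \<le> K" if "\<And>k. k \<le> l \<Longrightarrow> \<bar>g (x + real k *\<^sub>R c)\<bar> \<le> K" for l g x
    using that
  proof (induction l arbitrary: x)
    case (Suc l)
    have "\<bar>(A ^^ l) g x\<bar> \<le> K"
      by (rule Suc.IH) (use Suc.prems in auto)
    moreover have "\<bar>(A ^^ l) g (x + c)\<bar> \<le> K"
    proof (rule Suc.IH)
      fix k assume "k \<le> l"
      then show "\<bar>g (x + c + real k *\<^sub>R c)\<bar> \<le> K"
        using Suc.prems[of "Suc k"] by (simp add: algebra_simps)
    qed
    moreover have eq: "(A ^^ Suc l) g x = ((A ^^ l) g (x + c) + (A ^^ l) g x) / 2"
      by (simp add: A_def)
    moreover have "\<bar>(u + v) / 2\<bar> \<le> K" if "\<bar>v\<bar> \<le> K" "\<bar>u\<bar> \<le> K" for u v :: real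
      using that by (simp add: abs_le_iff)
    ultimately show ?case by metis
  next
    case 0
    from 0[of 0] show ?case by simp
  qed
  \<comment> \<open>Replacing \<open>A ^^ l\<close> by \<open>A ^^ Suc l\<close> costs half of an
    averaged difference of order \<open>Suc a\<close>, hence at most \<open>K / 2\<close>. After
    \<open>a\<close> replacements the difference with doubled step appears.\<close>
  have step: "\<bar>(dif c ^^ a) G x\<bar> \<le> \<bar>(dif c ^^ a) ((A ^^ l) G) x\<bar> + real l / 2 * K" if "l \<le> a" for l
    using that
  proof (induction l)
    case (Suc l)
    have "(dif c ^^ a) ((A ^^ Suc l) G) x = A ((dif c ^^ a) ((A ^^ l) G)) x"
      using swap[of a 1 "(A ^^ l) G"] by simp
    also have "\<dots> = (dif c ^^ a) ((A ^^ l) G) x + dif c ((dif c ^^ a) ((A ^^ l) G)) x / 2"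
      by (simp add: A_def dif_def field_simps)
    also have "dif c ((dif c ^^ a) ((A ^^ l) G)) x = (A ^^ l) ((dif c ^^ Suc a) G) x"
      using swap[of "Suc a" l G] by simp
    finally have "(dif c ^^ a) ((A ^^ Suc l) G) x
        = (dif c ^^ a) ((A ^^ l) G) x + (A ^^ l) ((dif c ^^ Suc a) G) x / 2" .
    moreover have "\<bar>(A ^^ l) ((dif c ^^ Suc a) G) x\<bar> \<le> K"
      by (rule A_bound) (use K Suc.prems in auto)
    ultimately show ?case
      using Suc by (simp add: field_simps)
  qed simp
  show ?thesis
    using step[of a] by (simp add: double_pow abs_mult)
qed

text \<open>A shift keeps the degree and the leading coefficient, so a difference lowers the degree.
  The disjunct \<open>q = 0\<close> carries the induction past constants, whose difference is the
  zero polynomial and again has degree 0.\<close>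

lemma dif_funpow_poly:
  fixes q :: "real poly"
  assumes "q = 0 \<or> degree q < r"
  shows "(dif c ^^ r) (poly q) x = 0"
  using assms
proof (induction r arbitrary: q)
  case (Suc r)
  define p where "p = pcompose q [:c, 1:] - q"
  have "dif c (poly q) = poly p"
    by (auto simp: p_def dif_def poly_pcompose fun_eq_iff algebra_simps)
  moreover have "p = 0 \<or> degree p < r"
  proof (cases "degree q = 0")
    case True
    then obtain a where "q = [:a:]" by (rule degree_eq_zeroE)
    then show ?thesis by (simp add: p_def)
  next
    case False
    have "degree (pcompose q [:c, 1:]) = degree q"
      by (simp add: degree_pcompose)
    moreover have "coeff (pcompose q [:c, 1:]) (degree q) = coeff q (degree q)"
      using lead_coeff_comp[of "[:c, 1:]" q] by (simp add: degree_pcompose)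
    ultimately have "p = 0 \<or> degree p < degree q"
      unfolding p_def using False degree_less_if_less_eqI[of "pcompose q [:c, 1:] - q" q]
      by (auto simp: degree_diff_le)
    then show ?thesis using Suc.prems False by auto
  qed
  ultimately show ?case
    using Suc.IH[of p] by (simp add: funpow_swap1)
qed simp

lemma finite_diff_poly:
  fixes q :: "real poly"
  assumes "degree q < r"
  shows "(\<Sum>k\<le>r. (-1) ^ (r - k) * real (r choose k) * poly q (y + real k * c)) = 0"
  using dif_funpow_poly[of q r c y] assms by (simp add: dif_funpow_sum)

section \<open>Tensor product Lagrange interpolation\<close>

text \<open>The nodes are the integers below \<open>r\<close>, measured in grid steps, so the same
  polynomials and constants serve every level and every window.\<close>

definition lagrange_basis :: "nat \<Rightarrow> nat \<Rightarrow> real poly" where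
  "lagrange_basis r k = (\<Prod>j\<in>{..<r} - {k}. smult (1 / (real k - real j)) [:- real j, 1:])"

lemma degree_lagrange_basis:
  assumes "k < r"
  shows "degree (lagrange_basis r k) < r"
proof -
  have "degree (lagrange_basis r k) \<le> (\<Sum>j\<in>{..<r} - {k}. 1)"
    unfolding lagrange_basis_def
    by (rule order.trans[OF degree_prod_sum_le]) (auto intro!: sum_mono simp del: sum_constant)
  also have "\<dots> = r - 1"
    using assms by simp
  finally show ?thesis using assms by linarith
qed

lemma poly_lagrange_basis:
  assumes "k < r" "i < r"
  shows "poly (lagrange_basis r k) (real i) = (if i = k then 1 else 0)"
proof (cases "i = k")
  case True
  then show ?thesis
    by (auto simp: lagrange_basis_def poly_prod diff_divide_distrib[symmetric] intro!: prod.neutral)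
next
  case False
  then show ?thesis
    using assms by (auto simp: lagrange_basis_def poly_prod prod_zero_iff intro!: bexI[of _ i])
qed

lemma lagrange_interpolation:
  fixes q :: "real poly"
  assumes "degree q < r"
  shows "(\<Sum>k<r. poly q (real k) * poly (lagrange_basis r k) y) = poly q y"
proof -
  define p where "p = (\<Sum>k<r. smult (poly q (real k)) (lagrange_basis r k))"
  have "p = q"
  proof (rule poly_eqI_degree)
    fix x assume "x \<in> real ` {..<r}"
    then obtain i where i: "i < r" "x = real i" by auto
    have "poly p x = (\<Sum>k<r. if k = i then poly q (real i) else 0)"
      unfolding p_def poly_sum
      by (rule sum.cong) (use i in \<open>auto simp: poly_lagrange_basis\<close>)
    then show "poly p x = poly q x" using i by simp
  next
    have "degree p < r"
      unfolding p_def using assms degree_lagrange_basis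
      by (intro degree_sum_less) (auto intro: le_less_trans[OF degree_smult_le])
    then show "degree p < card (real ` {..<r})"
      by (simp add: card_image)
    show "degree q < card (real ` {..<r})"
      using assms by (simp add: card_image)
  qed
  then have "poly q y = poly p y" by simp
  then show ?thesis
    by (simp add: p_def poly_sum)
qed

text \<open>\<open>L\<close> is a Lebesgue constant for \<open>{0..b}\<close>, an interval that will
  reach beyond the nodes because interpolants are also evaluated on the rest of the window.
  \<open>L \<ge> 1\<close> allows smaller powers of \<open>L\<close> to be replaced by larger
  ones.\<close>

lemma lagrange_bound:
  obtains L :: real where "L \<ge> 1"
    "\<And>y. 0 \<le> y \<Longrightarrow> y \<le> b \<Longrightarrow> (\<Sum>k<r. \<bar>poly (lagrange_basis r k) y\<bar>) \<le> L"
proof -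
  have "compact ((\<lambda>y. \<Sum>k<r. \<bar>poly (lagrange_basis r k) y\<bar>) ` {0..b})"
    by (intro compact_continuous_image continuous_intros) auto
  then obtain B where B: "\<And>y. y \<in> {0..b} \<Longrightarrow> norm (\<Sum>k<r. \<bar>poly (lagrange_basis r k) y\<bar>) \<le> B"
    by (meson bounded_iff compact_imp_bounded image_eqI)
  show thesis
  proof (rule that[of "max 1 B"])
    fix y assume "0 \<le> y" "y \<le> b"
    then show "(\<Sum>k<r. \<bar>poly (lagrange_basis r k) y\<bar>) \<le> max 1 B"
      using B[of y] by (auto simp: abs_le_iff)
  qed simp
qed

lemma sum_binomial_split_top:
  "(\<Sum>k\<le>r. (-1) ^ (r - k) * real (r choose k) * e k) =
    e r + (\<Sum>k<r. (-1) ^ (r - k) * real (r choose k) * e k)" for e :: "nat \<Rightarrow> real"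
proof -
  have "{..r} = insert r {..<r}" by auto
  then show ?thesis by simp
qed

lemma sum_choose_less: "(\<Sum>k<r. real (r choose k)) = 2 ^ r - 1"
proof -
  have "(\<Sum>k\<le>r. real (r choose k)) = 2 ^ r"
    using choose_row_sum[of r] by (metis of_nat_numeral of_nat_power of_nat_sum)
  moreover have "{..r} = insert r {..<r}" by auto
  ultimately show ?thesis by simp
qed

text \<open>The interpolation error vanishes at the nodes and has the same \<open>r\<close>-th differences as \<open>g\<close>,
  so it can be computed recursively from them.\<close>
lemma lagrange_error:
  fixes g :: "nat \<Rightarrow> real"
  assumes diff: "\<And>k. k + r \<le> N \<Longrightarrow>
      \<bar>\<Sum>l\<le>r. (-1) ^ (r - l) * real (r choose l) * g (k + l)\<bar> \<le> \<epsilon>"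
    and "\<epsilon> \<ge> 0" "k \<le> N"
  shows "\<bar>g k - (\<Sum>l<r. g l * poly (lagrange_basis r l) (real k))\<bar> \<le> 2 ^ (r * k) * \<epsilon>"
proof -
  define P where "P = (\<Sum>l<r. smult (g l) (lagrange_basis r l))"
  define e where "e k = g k - poly P (real k)" for k
  have degP: "degree P < r" if "r > 0"
    unfolding P_def using that degree_lagrange_basis
    by (intro degree_sum_less) (auto intro: le_less_trans[OF degree_smult_le])
  have e0: "e k = 0" if "k < r" for k
  proof -
    have "poly P (real k) = (\<Sum>l<r. if l = k then g k else 0)"
      unfolding P_def poly_sum
      by (rule sum.cong) (use that in \<open>auto simp: poly_lagrange_basis\<close>)
    then show ?thesis using that by (simp add: e_def)
  qed
  have "\<bar>e k\<bar> \<le> 2 ^ (r * k) * \<epsilon>" if "k \<le> N" for k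
    using that
  proof (induction k rule: less_induct)
    case (less k)
    show ?case
    proof (cases "k < r")
      case True
      then show ?thesis using e0 \<open>\<epsilon> \<ge> 0\<close> by simp
    next
      case False
      define j where "j = k - r"
      have k: "k = j + r" using False by (simp add: j_def)
      have "(\<Sum>l\<le>r. (-1) ^ (r - l) * real (r choose l) * poly P (real (j + l))) = 0"
      proof (cases "r = 0")
        case True
        then show ?thesis by (simp add: P_def)
      next
        case False
        then show ?thesis using finite_diff_poly[of P r "real j" 1] degP by simp
      qed
      then have "(\<Sum>l\<le>r. (-1) ^ (r - l) * real (r choose l) * e (j + l))
          = (\<Sum>l\<le>r. (-1) ^ (r - l) * real (r choose l) * g (j + l))"
        by (simp add: e_def algebra_simps sum_subtractf)
      with diff[of j] k less.prems
      have "\<bar>\<Sum>l\<le>r. (-1) ^ (r - l) * real (r choose l) * e (j + l)\<bar> \<le> \<epsilon>"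
        by simp
      \<comment> \<open>The newest error has coefficient 1 in the difference, so it can be solved
        for. The coefficients of the \<open>r\<close> preceding errors sum to
        \<open>2 ^ r - 1\<close> in absolute value, which is why the bound grows by the factor
        \<open>2 ^ r\<close> per node.\<close>
      then have "\<bar>e k\<bar> \<le> \<epsilon> + \<bar>\<Sum>l<r. (-1) ^ (r - l) * real (r choose l) * e (j + l)\<bar>"
        unfolding sum_binomial_split_top[where e = "\<lambda>l. e (j + l)"] k by linarith
      also have "\<bar>\<Sum>l<r. (-1) ^ (r - l) * real (r choose l) * e (j + l)\<bar>
          \<le> (\<Sum>l<r. real (r choose l) * (2 ^ (r * (k - 1)) * \<epsilon>))"
      proof (rule order.trans[OF sum_abs], rule sum_mono)
        fix l assume l: "l \<in> {..<r}"
        then have "\<bar>e (j + l)\<bar> \<le> 2 ^ (r * (j + l)) * \<epsilon>"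
          using less k by auto
        also have "\<dots> \<le> 2 ^ (r * (k - 1)) * \<epsilon>"
          using l k \<open>\<epsilon> \<ge> 0\<close> by (intro mult_right_mono power_increasing mult_left_mono) auto
        finally show "\<bar>(-1) ^ (r - l) * real (r choose l) * e (j + l)\<bar>
            \<le> real (r choose l) * (2 ^ (r * (k - 1)) * \<epsilon>)"
          by (simp add: abs_mult power_abs mult_left_mono)
      qed
      also have "\<dots> = (2 ^ r - 1) * (2 ^ (r * (k - 1)) * \<epsilon>)"
        by (simp add: sum_distrib_right[symmetric] sum_choose_less)
      finally have "\<bar>e k\<bar> \<le> \<epsilon> + (2 ^ r - 1) * (2 ^ (r * (k - 1)) * \<epsilon>)"
        by simp
      also have "\<dots> \<le> 2 ^ r * (2 ^ (r * (k - 1)) * \<epsilon>)"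
      proof -
        have "\<epsilon> * 1 \<le> \<epsilon> * 2 ^ (r * (k - 1))"
          using \<open>\<epsilon> \<ge> 0\<close> by (intro mult_left_mono) auto
        then show ?thesis by (simp add: algebra_simps)
      qed
      also have "\<dots> \<le> 2 ^ (r * k) * \<epsilon>"
      proof (cases "k = 0")
        case True
        then show ?thesis using False by simp
      next
        case False
        then have "r * k = r + r * (k - 1)"
          by (cases k) auto
        then show ?thesis by (simp add: power_add)
      qed
      finally show ?thesis .
    qed
  qed
  from this[OF \<open>k \<le> N\<close>] show ?thesis
    by (simp add: e_def P_def poly_sum)
qed

section \<open>Tensor products of Lagrange polynomials\<close>

definition tensor_interp :: "nat \<Rightarrow> (('n::finite \<Rightarrow> nat) \<Rightarrow> real) \<Rightarrow> ('n \<Rightarrow> real) \<Rightarrow> real" where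
  "tensor_interp r g z =
    (\<Sum>\<kappa>\<in>PiE UNIV (\<lambda>_. {..<r}). g \<kappa> * (\<Prod>j\<in>UNIV. poly (lagrange_basis r (\<kappa> j)) (z j)))"

lemma nodes_less: "\<kappa> \<in> PiE UNIV (\<lambda>_. {..<r::nat}) \<Longrightarrow> \<kappa> j < r"
  by (auto dest: PiE_mem)

lemma tensor_interp_diff:
  "tensor_interp r (\<lambda>\<kappa>. g \<kappa> - h \<kappa>) z = tensor_interp r g z - tensor_interp r h z"
  by (simp add: tensor_interp_def sum_subtractf algebra_simps)

text \<open>In each coordinate the basis polynomials sum to 1. This lets the value
  \<open>f x\<close> be moved inside the interpolation when an interpolant is compared with
  \<open>f x\<close> itself.\<close>

lemma tensor_interp_const:
  fixes z :: "'n::finite \<Rightarrow> real"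
  assumes "r > 0"
  shows "tensor_interp r (\<lambda>_. c) z = c"
proof -
  have "tensor_interp r (\<lambda>_. c) z = c * (\<Prod>j\<in>UNIV. \<Sum>k<r. poly (lagrange_basis r k) (z j))"
    unfolding tensor_interp_def sum_distrib_left[symmetric]
    by (subst prod_sum_PiE) auto
  also have "\<dots> = c * (\<Prod>j\<in>(UNIV::'n set). 1)"
    using lagrange_interpolation[of "[:1:]" r] assms by simp
  finally show ?thesis by simp
qed

text \<open>Because the nodes form the full product \<open>PiE UNIV\<close>, the sum of absolute
  values of the basis functions factors into one-dimensional Lebesgue functions, one factor
  \<open>L\<close> per coordinate.\<close>

lemma tensor_interp_bound:
  fixes g :: "('n::finite \<Rightarrow> nat) \<Rightarrow> real"
  assumes g: "\<And>\<kappa>. (\<And>j. \<kappa> j < r) \<Longrightarrow> \<bar>g \<kappa>\<bar> \<le> c"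
    and L: "\<And>j. (\<Sum>k<r. \<bar>poly (lagrange_basis r k) (z j)\<bar>) \<le> L"
    and "c \<ge> 0"
  shows "\<bar>tensor_interp r g z\<bar> \<le> L ^ CARD('n) * c"
proof -
  have "\<bar>tensor_interp r g z\<bar> \<le>
      (\<Sum>\<kappa>\<in>PiE UNIV (\<lambda>_. {..<r}). c * (\<Prod>j\<in>UNIV. \<bar>poly (lagrange_basis r (\<kappa> j)) (z j)\<bar>))"
    unfolding tensor_interp_def
  proof (rule order.trans[OF sum_abs], rule sum_mono)
    fix \<kappa> :: "'n \<Rightarrow> nat" assume "\<kappa> \<in> PiE UNIV (\<lambda>_. {..<r})"
    then have "\<bar>g \<kappa>\<bar> \<le> c" by (intro g nodes_less)
    then show "\<bar>g \<kappa> * (\<Prod>j\<in>UNIV. poly (lagrange_basis r (\<kappa> j)) (z j))\<bar>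
        \<le> c * (\<Prod>j\<in>UNIV. \<bar>poly (lagrange_basis r (\<kappa> j)) (z j)\<bar>)"
      by (simp add: abs_mult abs_prod mult_right_mono prod_nonneg)
  qed
  also have "\<dots> = c * (\<Prod>j\<in>(UNIV::'n set). \<Sum>k<r. \<bar>poly (lagrange_basis r k) (z j)\<bar>)"
    unfolding sum_distrib_left[symmetric] by (subst prod_sum_PiE) auto
  also have "\<dots> \<le> c * (\<Prod>j\<in>(UNIV::'n set). L)"
    using \<open>c \<ge> 0\<close> L by (intro mult_left_mono prod_mono) (auto intro: sum_nonneg)
  finally show ?thesis by (simp add: mult.commute)
qed

text \<open>An affine substitution keeps the degree in each coordinate below \<open>r\<close>, so
  one-dimensional interpolation is exact there and the double sum factors. \<open>A\<close> and
  \<open>b\<close> will be the offset and the stride of a set of nodes inside a finer grid.\<close>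

lemma tensor_interp_affine:
  fixes g :: "('n::finite \<Rightarrow> nat) \<Rightarrow> real"
  assumes "r > 0"
  shows "tensor_interp r (\<lambda>\<kappa>. tensor_interp r g (\<lambda>j. A j + b * real (\<kappa> j))) z
    = tensor_interp r g (\<lambda>j. A j + b * z j)"
proof -
  let ?P = "PiE UNIV (\<lambda>_. {..<r}) :: ('n \<Rightarrow> nat) set"
  let ?l = "\<lambda>k. poly (lagrange_basis r k)"
  have one: "(\<Sum>k<r. ?l m (A j + b * real k) * ?l k (z j)) = ?l m (A j + b * z j)" if "m < r" for m j
  proof -
    let ?q = "pcompose (lagrange_basis r m) [:A j, b:]"
    have "degree ?q \<le> degree (lagrange_basis r m)"
      using degree_pcompose_le[of "lagrange_basis r m" "[:A j, b:]"]
      by (auto split: if_splits)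
    then have "degree ?q < r" using degree_lagrange_basis[OF that] by linarith
    from lagrange_interpolation[OF this, of "z j"] show ?thesis
      by (simp add: poly_pcompose algebra_simps)
  qed
  have "tensor_interp r (\<lambda>\<kappa>. tensor_interp r g (\<lambda>j. A j + b * real (\<kappa> j))) z
     = (\<Sum>\<kappa>\<in>?P. \<Sum>\<mu>\<in>?P. g \<mu> * (\<Prod>j\<in>UNIV. ?l (\<mu> j) (A j + b * real (\<kappa> j)) * ?l (\<kappa> j) (z j)))"
    unfolding tensor_interp_def sum_distrib_right prod.distrib by (simp add: mult.assoc)
  also have "\<dots> = (\<Sum>\<mu>\<in>?P. g \<mu> *
      (\<Sum>\<kappa>\<in>?P. \<Prod>j\<in>UNIV. ?l (\<mu> j) (A j + b * real (\<kappa> j)) * ?l (\<kappa> j) (z j)))"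
    by (subst sum.swap) (simp add: sum_distrib_left)
  also have "\<dots> = (\<Sum>\<mu>\<in>?P. g \<mu> *
      (\<Prod>j\<in>UNIV. \<Sum>k<r. ?l (\<mu> j) (A j + b * real k) * ?l k (z j)))"
    by (subst prod_sum_PiE) auto
  also have "\<dots> = tensor_interp r g (\<lambda>j. A j + b * z j)"
    unfolding tensor_interp_def
    by (intro sum.cong arg_cong2[where f = "(*)"] prod.cong refl one nodes_less)
  finally show ?thesis .
qed

text \<open>The coordinates of \<open>\<kappa>\<close> are replaced by interpolation over the nodes
  one at a time. Each replacement costs a one-dimensional error times the Lebesgue constants of the
  coordinates already treated, at most \<open>L ^ CARD('n)\<close>.\<close>

lemma tensor_lagrange_error:
  fixes g :: "('n::finite \<Rightarrow> nat) \<Rightarrow> real"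
  assumes diff: "\<And>\<kappa> j. (\<And>i. \<kappa> i \<le> N) \<Longrightarrow> \<kappa> j + r \<le> N \<Longrightarrow>
      \<bar>\<Sum>l\<le>r. (-1) ^ (r - l) * real (r choose l) * g (\<kappa>(j := \<kappa> j + l))\<bar> \<le> \<epsilon>"
    and "\<epsilon> \<ge> 0" "r \<le> N" "L \<ge> 1"
    and L: "\<And>y. 0 \<le> y \<Longrightarrow> y \<le> real N \<Longrightarrow> (\<Sum>k<r. \<bar>poly (lagrange_basis r k) y\<bar>) \<le> L"
    and \<kappa>: "\<And>j. \<kappa> j \<le> N"
  shows "\<bar>g \<kappa> - tensor_interp r g (\<lambda>j. real (\<kappa> j))\<bar>
    \<le> real CARD('n) * L ^ CARD('n) * 2 ^ (r * N) * \<epsilon>"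
proof -
  let ?l = "\<lambda>j k. poly (lagrange_basis r k) (real (\<kappa> j))"
  define B where "B = L ^ CARD('n) * 2 ^ (r * N) * \<epsilon>"
  have one: "\<bar>g \<mu> - (\<Sum>k<r. g (\<mu>(j := k)) * ?l j k)\<bar> \<le> 2 ^ (r * N) * \<epsilon>"
    if \<mu>: "\<And>i. \<mu> i \<le> N" and j: "\<mu> j = \<kappa> j" for \<mu> j
  proof -
    have "\<bar>g (\<mu>(j := \<kappa> j)) - (\<Sum>k<r. g (\<mu>(j := k)) * ?l j k)\<bar> \<le> 2 ^ (r * \<kappa> j) * \<epsilon>"
    proof (rule lagrange_error[where N = N and g = "\<lambda>k. g (\<mu>(j := k))"])
      fix k assume "k + r \<le> N"
      then show "\<bar>\<Sum>l\<le>r. (-1) ^ (r - l) * real (r choose l) * g (\<mu>(j := k + l))\<bar> \<le> \<epsilon>"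
        using diff[of "\<mu>(j := k)" j] \<mu> by simp
    qed (use \<open>\<epsilon> \<ge> 0\<close> \<kappa> in auto)
    also have "\<dots> \<le> 2 ^ (r * N) * \<epsilon>"
      using \<kappa> \<open>\<epsilon> \<ge> 0\<close> by (intro mult_right_mono power_increasing mult_left_mono) auto
    finally show ?thesis using j[symmetric] by simp
  qed
  \<comment> \<open>A partially interpolated index: node \<open>\<mu>\<close> in the coordinates
    already treated, the original \<open>\<kappa>\<close> in the others.\<close>
  define h where "h S \<mu> = (\<lambda>i. if i \<in> S then \<mu> i else \<kappa> i)" for S and \<mu> :: "'n \<Rightarrow> nat"
  have main: "\<bar>g \<kappa> - (\<Sum>\<mu>\<in>PiE S (\<lambda>_. {..<r}). g (h S \<mu>) * (\<Prod>j\<in>S. ?l j (\<mu> j)))\<bar>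
      \<le> real (card S) * B" for S
  proof -
    have "finite S" by simp
    then show ?thesis
    proof (induction S rule: finite_induct)
      case empty
      then show ?case by (simp add: h_def)
    next
      case (insert a S)
      let ?P = "PiE S (\<lambda>_. {..<r})"
      let ?w = "\<lambda>\<mu>. \<Prod>j\<in>S. ?l j (\<mu> j)"
      have "(\<Sum>\<mu>\<in>PiE (insert a S) (\<lambda>_. {..<r}).
            g (h (insert a S) \<mu>) * (\<Prod>j\<in>insert a S. ?l j (\<mu> j)))
          = (\<Sum>(k, \<mu>)\<in>{..<r} \<times> ?P. g (h (insert a S) (\<mu>(a := k))) *
              (\<Prod>j\<in>insert a S. ?l j ((\<mu>(a := k)) j)))"
        unfolding PiE_insert_eq
        by (subst sum.reindex[OF inj_combinator[OF insert.hyps(2)]])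
          (simp add: case_prod_unfold)
      also have "\<dots> = (\<Sum>(k, \<mu>)\<in>{..<r} \<times> ?P. g ((h S \<mu>)(a := k)) * (?l a k * ?w \<mu>))"
      proof (intro sum.cong refl, clarify)
        fix k \<mu>
        have "h (insert a S) (\<mu>(a := k)) = (h S \<mu>)(a := k)"
          by (auto simp: h_def)
        moreover have "(\<Prod>j\<in>S. ?l j ((\<mu>(a := k)) j)) = ?w \<mu>"
          using insert.hyps by (intro prod.cong) auto
        ultimately show "g (h (insert a S) (\<mu>(a := k))) * (\<Prod>j\<in>insert a S. ?l j ((\<mu>(a := k)) j))
            = g ((h S \<mu>)(a := k)) * (?l a k * ?w \<mu>)"
          using insert.hyps by simp
      qed
      also have "\<dots> = (\<Sum>\<mu>\<in>?P. ?w \<mu> * (\<Sum>k<r. g ((h S \<mu>)(a := k)) * ?l a k))"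
        by (subst sum.cartesian_product[symmetric], subst sum.swap)
          (simp add: sum_distrib_left mult_ac)
      finally have eq: "(\<Sum>\<mu>\<in>PiE (insert a S) (\<lambda>_. {..<r}).
            g (h (insert a S) \<mu>) * (\<Prod>j\<in>insert a S. ?l j (\<mu> j)))
          = (\<Sum>\<mu>\<in>?P. ?w \<mu> * (\<Sum>k<r. g ((h S \<mu>)(a := k)) * ?l a k))" .
      have "\<bar>(\<Sum>\<mu>\<in>?P. g (h S \<mu>) * ?w \<mu>) - (\<Sum>\<mu>\<in>?P. ?w \<mu> * (\<Sum>k<r. g ((h S \<mu>)(a := k)) * ?l a k))\<bar>
          = \<bar>\<Sum>\<mu>\<in>?P. ?w \<mu> * (g (h S \<mu>) - (\<Sum>k<r. g ((h S \<mu>)(a := k)) * ?l a k))\<bar>"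
        by (simp add: sum_subtractf algebra_simps)
      also have "\<dots> \<le> (\<Sum>\<mu>\<in>?P. (\<Prod>j\<in>S. \<bar>?l j (\<mu> j)\<bar>) * (2 ^ (r * N) * \<epsilon>))"
      proof (rule order.trans[OF sum_abs], rule sum_mono)
        fix \<mu> assume \<mu>: "\<mu> \<in> ?P"
        have "\<bar>g (h S \<mu>) - (\<Sum>k<r. g ((h S \<mu>)(a := k)) * ?l a k)\<bar> \<le> 2 ^ (r * N) * \<epsilon>"
        proof (rule one)
          fix i show "h S \<mu> i \<le> N"
            using PiE_mem[OF \<mu>, of i] \<kappa>[of i] \<open>r \<le> N\<close> by (auto simp: h_def)
        qed (use insert.hyps in \<open>simp add: h_def\<close>)
        then show "\<bar>?w \<mu> * (g (h S \<mu>) - (\<Sum>k<r. g ((h S \<mu>)(a := k)) * ?l a k))\<bar>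
            \<le> (\<Prod>j\<in>S. \<bar>?l j (\<mu> j)\<bar>) * (2 ^ (r * N) * \<epsilon>)"
          by (simp add: abs_mult abs_prod mult_left_mono prod_nonneg)
      qed
      also have "\<dots> = (\<Prod>j\<in>S. \<Sum>k<r. \<bar>?l j k\<bar>) * (2 ^ (r * N) * \<epsilon>)"
        unfolding sum_distrib_right[symmetric] by (subst prod_sum_PiE) auto
      also have "\<dots> \<le> L ^ CARD('n) * (2 ^ (r * N) * \<epsilon>)"
      proof (rule mult_right_mono)
        have "(\<Prod>j\<in>S. \<Sum>k<r. \<bar>?l j k\<bar>) \<le> (\<Prod>j\<in>S. L)"
          using L \<kappa> by (intro prod_mono) (auto intro: sum_nonneg)
        also have "\<dots> \<le> L ^ CARD('n)"
          using \<open>L \<ge> 1\<close> by (simp add: power_increasing card_mono)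
        finally show "(\<Prod>j\<in>S. \<Sum>k<r. \<bar>?l j k\<bar>) \<le> L ^ CARD('n)" .
      qed (use \<open>\<epsilon> \<ge> 0\<close> in simp)
      finally have "\<bar>(\<Sum>\<mu>\<in>?P. g (h S \<mu>) * ?w \<mu>)
          - (\<Sum>\<mu>\<in>?P. ?w \<mu> * (\<Sum>k<r. g ((h S \<mu>)(a := k)) * ?l a k))\<bar> \<le> B"
        by (simp add: B_def mult.assoc)
      then have "\<bar>g \<kappa> - (\<Sum>\<mu>\<in>?P. ?w \<mu> * (\<Sum>k<r. g ((h S \<mu>)(a := k)) * ?l a k))\<bar>
          \<le> real (card S) * B + B"
        using insert.IH by linarith
      then show ?case
        unfolding eq using insert.hyps by (simp add: algebra_simps)
    qed
  qed
  have "h UNIV \<mu> = \<mu>" for \<mu> by (auto simp: h_def)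
  with main[of UNIV] show ?thesis
    by (simp add: tensor_interp_def B_def mult.assoc)
qed

lemma tensor_interp_finite_diff:
  fixes z :: "'n::finite \<Rightarrow> real"
  shows "(\<Sum>k\<le>r. (-1) ^ (r - k) * real (r choose k) *
      tensor_interp r g (z(i := z i + real k * c))) = 0"
proof -
  let ?l = "\<lambda>\<kappa> j. poly (lagrange_basis r (\<kappa> j))"
  let ?P = "PiE UNIV (\<lambda>_. {..<r}) :: ('n \<Rightarrow> nat) set"
  have "tensor_interp r g (z(i := y)) =
      (\<Sum>\<kappa>\<in>?P. (g \<kappa> * (\<Prod>j\<in>UNIV - {i}. ?l \<kappa> j (z j))) * ?l \<kappa> i y)" for y
    unfolding tensor_interp_def
    by (subst prod.remove[of UNIV i]) (auto simp: mult_ac)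
  then have "(\<Sum>k\<le>r. (-1) ^ (r - k) * real (r choose k) *
        tensor_interp r g (z(i := z i + real k * c)))
      = (\<Sum>k\<le>r. \<Sum>\<kappa>\<in>?P. (g \<kappa> * (\<Prod>j\<in>UNIV - {i}. ?l \<kappa> j (z j))) *
        ((-1) ^ (r - k) * real (r choose k) * ?l \<kappa> i (z i + real k * c)))"
    by (simp add: sum_distrib_left mult_ac)
  also have "\<dots> = (\<Sum>\<kappa>\<in>?P. (g \<kappa> * (\<Prod>j\<in>UNIV - {i}. ?l \<kappa> j (z j))) *
        (\<Sum>k\<le>r. (-1) ^ (r - k) * real (r choose k) * ?l \<kappa> i (z i + real k * c)))"
    by (subst sum.swap) (simp add: sum_distrib_left)
  also have "\<dots> = 0"
  proof (intro sum.neutral ballI)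
    fix \<kappa> :: "'n \<Rightarrow> nat" assume "\<kappa> \<in> ?P"
    then show "(g \<kappa> * (\<Prod>j\<in>UNIV - {i}. ?l \<kappa> j (z j))) *
        (\<Sum>k\<le>r. (-1) ^ (r - k) * real (r choose k) * ?l \<kappa> i (z i + real k * c)) = 0"
      by (simp only: finite_diff_poly[OF degree_lagrange_basis[OF nodes_less]] mult_zero_right)
  qed
  finally show ?thesis .
qed

section \<open>Approximation on dyadic windows\<close>

definition grid_point :: "nat \<Rightarrow> ('n \<Rightarrow> nat) \<Rightarrow> real ^ 'n::finite" where
  "grid_point m b = (\<chi> j. real (b j) / 2 ^ m)"

text \<open>\<open>b\<close> is the lower corner of the window, counted in steps of level
  \<open>m\<close>, and \<open>x\<close> is passed on in grid steps from that corner. The side of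
  the window is left open; only the first \<open>r\<close> nodes in each direction enter.\<close>

definition window_interp ::
    "nat \<Rightarrow> (real ^ 'n \<Rightarrow> real) \<Rightarrow> nat \<Rightarrow> ('n::finite \<Rightarrow> nat) \<Rightarrow> real ^ 'n \<Rightarrow> real" where
  "window_interp r f m b x =
    tensor_interp r (\<lambda>\<kappa>. f (grid_point m (\<lambda>j. b j + \<kappa> j))) (\<lambda>j. 2 ^ m * x $ j - real (b j))"

text \<open>Real-valued counterpart of
  \<open>discrete_modulus r f (int m) \<le> ennreal \<epsilon>\<close> over natural multi-indices,
  which keeps the approximation argument free of \<open>ennreal\<close> and of integer
  levels.\<close>

definition discrete_bound :: "nat \<Rightarrow> (real ^ 'n::finite \<Rightarrow> real) \<Rightarrow> nat \<Rightarrow> real \<Rightarrow> bool" where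
  "discrete_bound r f m \<epsilon> \<longleftrightarrow> (\<forall>i b. (\<forall>j. b j \<le> 2 ^ m) \<and> b i + r \<le> 2 ^ m \<longrightarrow>
    \<bar>finite_diff r ((1 / 2 ^ m) *\<^sub>R axis i 1) f (grid_point m b)\<bar> \<le> \<epsilon>)"

lemma discrete_boundD:
  assumes "discrete_bound r f m \<epsilon>" "\<And>j. b j \<le> 2 ^ m" "b i + r \<le> 2 ^ m"
  shows "\<bar>\<Sum>l\<le>r. (-1) ^ (r - l) * real (r choose l) * f (grid_point m (b(i := b i + l)))\<bar> \<le> \<epsilon>"
proof -
  have "grid_point m b + real l *\<^sub>R ((1 / 2 ^ m) *\<^sub>R axis i 1) = grid_point m (b(i := b i + l))" for l
    by (vector grid_point_def axis_def) (auto simp: add_divide_distrib)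
  then have "finite_diff r ((1 / 2 ^ m) *\<^sub>R axis i 1) f (grid_point m b) =
      (\<Sum>l\<le>r. (-1) ^ (r - l) * real (r choose l) * f (grid_point m (b(i := b i + l))))"
    by (simp add: finite_diff_def)
  then show ?thesis using assms unfolding discrete_bound_def by metis
qed

lemma fine_interp_error:
  fixes f :: "real ^ 'n::finite \<Rightarrow> real"
  assumes bound: "discrete_bound r f m \<epsilon>" and "\<epsilon> \<ge> 0" "r \<le> N" "L \<ge> 1"
    and L: "\<And>y. 0 \<le> y \<Longrightarrow> y \<le> real N \<Longrightarrow> (\<Sum>k<r. \<bar>poly (lagrange_basis r k) y\<bar>) \<le> L"
    and c: "\<And>j. c j + N \<le> 2 ^ m"
    and \<kappa>: "\<And>j. \<kappa> j \<le> N"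
  shows "\<bar>f (grid_point m (\<lambda>j. c j + \<kappa> j))
      - tensor_interp r (\<lambda>\<mu>. f (grid_point m (\<lambda>j. c j + \<mu> j))) (\<lambda>j. real (\<kappa> j))\<bar>
    \<le> real CARD('n) * L ^ CARD('n) * 2 ^ (r * N) * \<epsilon>"
proof (rule tensor_lagrange_error[where g = "\<lambda>\<kappa>. f (grid_point m (\<lambda>j. c j + \<kappa> j))"])
  fix \<kappa> :: "'n \<Rightarrow> nat" and j assume \<kappa>: "\<And>i. \<kappa> i \<le> N" "\<kappa> j + r \<le> N"
  have "(\<lambda>i. c i + (\<kappa>(j := \<kappa> j + l)) i) = (\<lambda>i. c i + \<kappa> i)(j := c j + \<kappa> j + l)" for l
    by auto
  moreover have "\<bar>\<Sum>l\<le>r. (-1) ^ (r - l) * real (r choose l) *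
      f (grid_point m ((\<lambda>i. c i + \<kappa> i)(j := c j + \<kappa> j + l)))\<bar> \<le> \<epsilon>"
  proof (rule discrete_boundD[OF bound])
    show "c i + \<kappa> i \<le> 2 ^ m" for i
      using c[of i] \<kappa>(1)[of i] by linarith
    show "c j + \<kappa> j + r \<le> 2 ^ m"
      using c[of j] \<kappa>(2) by linarith
  qed
  ultimately show "\<bar>\<Sum>l\<le>r. (-1) ^ (r - l) * real (r choose l) *
      f (grid_point m (\<lambda>i. c i + (\<kappa>(j := \<kappa> j + l)) i))\<bar> \<le> \<epsilon>"
    by simp
qed (use assms in auto)

text \<open>\<open>o'\<close> and \<open>s\<close> single out a subgrid. At its nodes
  \<open>f\<close> differs from the fine interpolant by the error of
  \<open>fine_interp_error\<close>. Interpolating this difference costs one more factor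
  \<open>L ^ CARD('n)\<close>, and by \<open>tensor_interp_affine\<close> the fine interpolant
  itself is reproduced exactly.\<close>

lemma coarse_interp_diff:
  fixes f :: "real ^ 'n::finite \<Rightarrow> real"
  assumes bound: "discrete_bound r f m \<epsilon>" and "\<epsilon> \<ge> 0" "0 < r" "r \<le> N" "L \<ge> 1"
    and L: "\<And>y. 0 \<le> y \<Longrightarrow> y \<le> real N \<Longrightarrow> (\<Sum>k<r. \<bar>poly (lagrange_basis r k) y\<bar>) \<le> L"
    and c: "\<And>j. c j + N \<le> 2 ^ m"
    and os: "\<And>j k. k < r \<Longrightarrow> o' j + s * k \<le> N"
    and z: "\<And>j. 0 \<le> z j" "\<And>j. z j \<le> real N"
  shows "\<bar>tensor_interp r (\<lambda>\<kappa>. f (grid_point m (\<lambda>j. c j + (o' j + s * \<kappa> j)))) z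
      - tensor_interp r (\<lambda>\<mu>. f (grid_point m (\<lambda>j. c j + \<mu> j))) (\<lambda>j. real (o' j) + real s * z j)\<bar>
    \<le> L ^ CARD('n) * (real CARD('n) * L ^ CARD('n) * 2 ^ (r * N) * \<epsilon>)"
proof -
  let ?q = "tensor_interp r (\<lambda>\<mu>. f (grid_point m (\<lambda>j. c j + \<mu> j)))"
  have "\<bar>tensor_interp r (\<lambda>\<kappa>. f (grid_point m (\<lambda>j. c j + (o' j + s * \<kappa> j)))
        - ?q (\<lambda>j. real (o' j) + real s * real (\<kappa> j))) z\<bar>
      \<le> L ^ CARD('n) * (real CARD('n) * L ^ CARD('n) * 2 ^ (r * N) * \<epsilon>)"
  proof (rule tensor_interp_bound)
    fix \<kappa> :: "'n \<Rightarrow> nat" assume "\<And>j. \<kappa> j < r"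
    then have "o' j + s * \<kappa> j \<le> N" for j using os by blast
    from fine_interp_error[OF bound \<open>\<epsilon> \<ge> 0\<close> \<open>r \<le> N\<close> \<open>L \<ge> 1\<close> L c this]
    show "\<bar>f (grid_point m (\<lambda>j. c j + (o' j + s * \<kappa> j)))
        - ?q (\<lambda>j. real (o' j) + real s * real (\<kappa> j))\<bar>
        \<le> real CARD('n) * L ^ CARD('n) * 2 ^ (r * N) * \<epsilon>" by simp
  qed (use L z assms in auto)
  then show ?thesis
    unfolding tensor_interp_diff tensor_interp_affine[OF \<open>0 < r\<close>] .
qed

text \<open>\<open>b'\<close> selects in each coordinate the half of the window that contains \<open>x\<close>. Both interpolants are
  compared with the one through the first nodes of the refined grid on the whole window.\<close>
lemma window_interp_refine:
  fixes f :: "real ^ 'n::finite \<Rightarrow> real"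
  assumes bound: "discrete_bound r f (Suc m) \<epsilon>" and "\<epsilon> \<ge> 0" "0 < r" "r \<le> N" "L \<ge> 1"
    and L: "\<And>y. 0 \<le> y \<Longrightarrow> y \<le> real (2 * N) \<Longrightarrow> (\<Sum>k<r. \<bar>poly (lagrange_basis r k) y\<bar>) \<le> L"
    and b: "\<And>j. b j + N \<le> 2 ^ m"
    and x: "\<And>j. 0 \<le> 2 ^ m * x $ j - real (b j)" "\<And>j. 2 ^ m * x $ j - real (b j) \<le> real N"
  obtains b' where "\<And>j. b' j + N \<le> 2 ^ Suc m"
    "\<And>j. 0 \<le> 2 ^ Suc m * x $ j - real (b' j)" "\<And>j. 2 ^ Suc m * x $ j - real (b' j) \<le> real N"
    "\<bar>window_interp r f m b x - window_interp r f (Suc m) b' x\<bar>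
      \<le> 2 * (L ^ CARD('n) * (real CARD('n) * L ^ CARD('n) * 2 ^ (r * (2 * N)))) * \<epsilon>"
proof -
  \<comment> \<open>A window of side \<open>N\<close> has side \<open>2 * N\<close> in steps of the
    next level, so the offset is 0 for the lower half and \<open>N\<close> for the upper
    one.\<close>
  define o' where "o' j = (if 2 ^ Suc m * x $ j - real (2 * b j) \<le> real N then 0 else N)" for j
  define b' where "b' j = 2 * b j + o' j" for j
  let ?M = "Suc m"
  let ?q = "tensor_interp r (\<lambda>\<mu>. f (grid_point ?M (\<lambda>j. 2 * b j + \<mu> j)))
      (\<lambda>j. 2 ^ ?M * x $ j - real (2 * b j))"
  let ?E = "L ^ CARD('n) * (real CARD('n) * L ^ CARD('n) * 2 ^ (r * (2 * N)) * \<epsilon>)"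
  have c: "2 * b j + 2 * N \<le> 2 ^ ?M" for j using b[of j] by simp
  \<comment> \<open>Seen from the finer grid, the old nodes have offset 0 and stride 2.\<close>
  have 1: "\<bar>window_interp r f m b x - ?q\<bar> \<le> ?E"
  proof -
    have "grid_point ?M (\<lambda>j. 2 * b j + (0 + 2 * \<kappa> j)) = grid_point m (\<lambda>j. b j + \<kappa> j)" for \<kappa> :: "'n \<Rightarrow> nat"
      by (simp add: grid_point_def vec_eq_iff field_simps)
    moreover have "\<bar>tensor_interp r (\<lambda>\<kappa>. f (grid_point ?M (\<lambda>j. 2 * b j + (0 + 2 * \<kappa> j))))
          (\<lambda>j. 2 ^ m * x $ j - real (b j))
        - tensor_interp r (\<lambda>\<mu>. f (grid_point ?M (\<lambda>j. 2 * b j + \<mu> j)))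
          (\<lambda>j. real 0 + real 2 * (2 ^ m * x $ j - real (b j)))\<bar> \<le> ?E"
    proof (rule coarse_interp_diff[OF bound \<open>\<epsilon> \<ge> 0\<close> \<open>0 < r\<close> _ \<open>L \<ge> 1\<close> L c])
      show "0 + 2 * k \<le> 2 * N" if "k < r" for k using that \<open>r \<le> N\<close> by simp
      show "2 ^ m * x $ j - real (b j) \<le> real (2 * N)" for j using x(2)[of j] by simp
    qed (use x \<open>r \<le> N\<close> in auto)
    ultimately show ?thesis
      by (simp add: window_interp_def algebra_simps)
  qed
  have x': "0 \<le> 2 ^ ?M * x $ j - real (b' j)" "2 ^ ?M * x $ j - real (b' j) \<le> real N" for j
    using x[of j] by (auto simp: b'_def o'_def)
  \<comment> \<open>The nodes of the selected half have offset \<open>o'\<close> and stride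
    1.\<close>
  have 2: "\<bar>window_interp r f ?M b' x - ?q\<bar> \<le> ?E"
  proof -
    have "\<bar>tensor_interp r (\<lambda>\<kappa>. f (grid_point ?M (\<lambda>j. 2 * b j + (o' j + 1 * \<kappa> j))))
          (\<lambda>j. 2 ^ ?M * x $ j - real (b' j))
        - tensor_interp r (\<lambda>\<mu>. f (grid_point ?M (\<lambda>j. 2 * b j + \<mu> j)))
          (\<lambda>j. real (o' j) + real 1 * (2 ^ ?M * x $ j - real (b' j)))\<bar> \<le> ?E"
    proof (rule coarse_interp_diff[OF bound \<open>\<epsilon> \<ge> 0\<close> \<open>0 < r\<close> _ \<open>L \<ge> 1\<close> L c])
      show "o' j + 1 * k \<le> 2 * N" if "k < r" for j k using that \<open>r \<le> N\<close> by (simp add: o'_def)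
      show "2 ^ ?M * x $ j - real (b' j) \<le> real (2 * N)" for j using x'(2)[of j] by simp
    qed (use x' \<open>r \<le> N\<close> in auto)
    then show ?thesis
      by (simp add: window_interp_def b'_def algebra_simps)
  qed
  show thesis
  proof (rule that[of b'])
    show "b' j + N \<le> 2 ^ ?M" for j using b[of j] by (simp add: b'_def o'_def)
    show "\<bar>window_interp r f m b x - window_interp r f ?M b' x\<bar>
      \<le> 2 * (L ^ CARD('n) * (real CARD('n) * L ^ CARD('n) * 2 ^ (r * (2 * N)))) * \<epsilon>"
      using 1 2 by (simp add: mult.assoc)
  qed (use x' in auto)
qed

section \<open>Convergence of the window interpolants\<close>

lemma grid_point_in_cube:
  assumes "\<And>j. b j \<le> 2 ^ m"
  shows "grid_point m b \<in> unit_cube"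
proof -
  have "real (b j) \<le> 2 ^ m" for j
    using assms[of j] by (metis of_nat_le_iff of_nat_numeral of_nat_power)
  then show ?thesis
    by (auto simp: unit_cube_def mem_box_cart grid_point_def divide_le_eq)
qed

lemma mem_unit_cube: "x \<in> unit_cube \<longleftrightarrow> (\<forall>j. 0 \<le> x $ j \<and> x $ j \<le> 1)"
  by (auto simp: unit_cube_def mem_box_cart)

lemma window_in_cube:
  assumes "\<And>j. b j + N \<le> 2 ^ m"
    and "\<And>j. 0 \<le> 2 ^ m * x $ j - real (b j)" "\<And>j. 2 ^ m * x $ j - real (b j) \<le> real N"
  shows "x \<in> unit_cube"
  unfolding mem_unit_cube
proof
  fix j
  have "real (b j) + real N \<le> 2 ^ m"
    using assms(1)[of j] by (metis of_nat_add of_nat_le_iff of_nat_numeral of_nat_power)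
  then have "2 ^ m * x $ j \<le> 2 ^ m * 1" "2 ^ m * 0 \<le> 2 ^ m * x $ j"
    using assms(2,3)[of j] by linarith+
  then show "0 \<le> x $ j \<and> x $ j \<le> 1"
    by (subst (asm) (1 2) mult_le_cancel_left_pos) simp_all
qed

text \<open>Windows shrink with the level, so uniform continuity brings all node values close to
  \<open>f x\<close>, and reproduction of constants together with stability passes this on to the
  interpolant. \<open>M\<close> is uniform in window and point, because the window is not known in
  advance but arises from successive halving.\<close>

lemma window_interp_limit:
  fixes f :: "real ^ 'n::finite \<Rightarrow> real"
  assumes cont: "continuous_on unit_cube f" and "\<delta> > 0" "0 < r" "r \<le> N" "L \<ge> 1"
    and L: "\<And>y. 0 \<le> y \<Longrightarrow> y \<le> real N \<Longrightarrow> (\<Sum>k<r. \<bar>poly (lagrange_basis r k) y\<bar>) \<le> L"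
  obtains M where "\<And>m b x. m \<ge> M \<Longrightarrow> (\<And>j. b j + N \<le> 2 ^ m) \<Longrightarrow>
      (\<And>j. 0 \<le> 2 ^ m * x $ j - real (b j)) \<Longrightarrow> (\<And>j. 2 ^ m * x $ j - real (b j) \<le> real N) \<Longrightarrow>
      \<bar>f x - window_interp r f m b x\<bar> \<le> \<delta>"
proof -
  define \<eta> where "\<eta> = \<delta> / L ^ CARD('n)"
  have "\<eta> > 0" using assms by (simp add: \<eta>_def)
  have "uniformly_continuous_on unit_cube f"
    using cont by (intro compact_uniformly_continuous) (auto simp: unit_cube_def)
  then obtain d where d: "d > 0" "\<And>x y. x \<in> unit_cube \<Longrightarrow> y \<in> unit_cube \<Longrightarrow> dist y x < d \<Longrightarrow>
      dist (f y) (f x) < \<eta>"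
    using \<open>\<eta> > 0\<close> unfolding uniformly_continuous_on_def by metis
  have "(\<lambda>m. real CARD('n) * real N * (1 / 2) ^ m) \<longlonglongrightarrow> real CARD('n) * real N * 0"
    by (intro tendsto_intros) auto
  then have "eventually (\<lambda>m. real CARD('n) * real N * (1 / 2) ^ m < d) sequentially"
    using \<open>d > 0\<close> by (intro order_tendstoD) auto
  then obtain M where M: "\<And>m. m \<ge> M \<Longrightarrow> real CARD('n) * real N * (1 / 2) ^ m < d"
    by (auto simp: eventually_sequentially)
  show thesis
  proof (rule that[of M])
    fix m b and x :: "real ^ 'n"
    assume m: "m \<ge> M" and b: "\<And>j. b j + N \<le> 2 ^ m"
      and x: "\<And>j. 0 \<le> 2 ^ m * x $ j - real (b j)" "\<And>j. 2 ^ m * x $ j - real (b j) \<le> real N"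
    have "\<bar>tensor_interp r (\<lambda>\<kappa>. f x - f (grid_point m (\<lambda>j. b j + \<kappa> j)))
        (\<lambda>j. 2 ^ m * x $ j - real (b j))\<bar> \<le> L ^ CARD('n) * \<eta>"
    proof (rule tensor_interp_bound)
      fix \<kappa> :: "'n \<Rightarrow> nat" assume \<kappa>: "\<And>j. \<kappa> j < r"
      let ?p = "grid_point m (\<lambda>j. b j + \<kappa> j)"
      have "norm (?p - x) \<le> (\<Sum>j\<in>UNIV. \<bar>(?p - x) $ j\<bar>)"
        by (rule norm_le_l1_cart)
      also have "\<dots> \<le> (\<Sum>j\<in>(UNIV::'n set). real N * (1 / 2) ^ m)"
      proof (rule sum_mono)
        fix j
        have "real (\<kappa> j) \<le> real N" using \<kappa>[of j] \<open>r \<le> N\<close> by simp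
        moreover have "2 ^ m * (?p - x) $ j = real (\<kappa> j) - (2 ^ m * x $ j - real (b j))"
          by (simp add: grid_point_def field_simps)
        ultimately have "\<bar>2 ^ m * (?p - x) $ j\<bar> \<le> real N"
          using x[of j] by linarith
        then have "2 ^ m * \<bar>(?p - x) $ j\<bar> \<le> real N"
          by (simp only: abs_mult) simp
        then show "\<bar>(?p - x) $ j\<bar> \<le> real N * (1 / 2) ^ m"
          by (simp add: power_divide pos_le_divide_eq mult.commute)
      qed
      also have "\<dots> < d" using M[OF m] by simp
      finally have "dist ?p x < d" by (simp add: dist_norm)
      moreover have "x \<in> unit_cube" by (rule window_in_cube[OF b x])
      moreover have "?p \<in> unit_cube"
      proof (rule grid_point_in_cube)
        show "b j + \<kappa> j \<le> 2 ^ m" for j using b[of j] \<kappa>[of j] \<open>r \<le> N\<close> by linarith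
      qed
      ultimately have "dist (f ?p) (f x) < \<eta>" using d by blast
      then show "\<bar>f x - f ?p\<bar> \<le> \<eta>" by (simp add: dist_real_def)
    qed (use L x \<open>\<eta> > 0\<close> in auto)
    then show "\<bar>f x - window_interp r f m b x\<bar> \<le> \<delta>"
      unfolding tensor_interp_diff tensor_interp_const[OF \<open>0 < r\<close>] window_interp_def \<eta>_def
      using \<open>L \<ge> 1\<close> by simp
  qed
qed

lemma window_interp_error:
  fixes f :: "real ^ 'n::finite \<Rightarrow> real"
  assumes cont: "continuous_on unit_cube f" and "0 < r" "r \<le> N" "L \<ge> 1"
    and L: "\<And>y. 0 \<le> y \<Longrightarrow> y \<le> real (2 * N) \<Longrightarrow> (\<Sum>k<r. \<bar>poly (lagrange_basis r k) y\<bar>) \<le> L"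
    and \<psi>: "\<And>m. \<psi> m \<ge> 0" "summable \<psi>" "\<And>m. m > n \<Longrightarrow> discrete_bound r f m (\<psi> m)"
    and b: "\<And>j. b j + N \<le> 2 ^ n"
    and x: "\<And>j. 0 \<le> 2 ^ n * x $ j - real (b j)" "\<And>j. 2 ^ n * x $ j - real (b j) \<le> real N"
  shows "\<bar>f x - window_interp r f n b x\<bar>
    \<le> 2 * (L ^ CARD('n) * (real CARD('n) * L ^ CARD('n) * 2 ^ (r * (2 * N)))) * (\<Sum>k. \<psi> (n + k))"
proof (rule field_le_epsilon)
  fix \<delta> :: real assume "\<delta> > 0"
  define C where "C = 2 * (L ^ CARD('n) * (real CARD('n) * L ^ CARD('n) * 2 ^ (r * (2 * N))))"
  have "C \<ge> 0" using \<open>L \<ge> 1\<close> by (simp add: C_def)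
  obtain M where M: "\<And>m b x. m \<ge> M \<Longrightarrow> (\<And>j. b j + N \<le> 2 ^ m) \<Longrightarrow>
      (\<And>j. 0 \<le> 2 ^ m * x $ j - real (b j)) \<Longrightarrow> (\<And>j. 2 ^ m * x $ j - real (b j) \<le> real N) \<Longrightarrow>
      \<bar>f x - window_interp r f m b x\<bar> \<le> \<delta>"
    by (rule window_interp_limit[OF cont \<open>\<delta> > 0\<close> \<open>0 < r\<close> \<open>r \<le> N\<close> \<open>L \<ge> 1\<close>, of thesis]) (use L in auto)
  \<comment> \<open>Induction on the number \<open>p\<close> of halvings left until the limit
    estimate applies. The window is generalized, since each halving selects a new one.\<close>
  have chain: "\<bar>f x - window_interp r f m b x\<bar> \<le> C * (\<Sum>k<p. \<psi> (Suc m + k)) + \<delta>"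
    if "m + p \<ge> M" "m \<ge> n" "\<And>j. b j + N \<le> 2 ^ m"
      "\<And>j. 0 \<le> 2 ^ m * x $ j - real (b j)" "\<And>j. 2 ^ m * x $ j - real (b j) \<le> real N" for p m b
    using that
  proof (induction p arbitrary: m b)
    case 0
    then show ?case using M[of m b x] by simp
  next
    case (Suc p)
    obtain b' where b': "\<And>j. b' j + N \<le> 2 ^ Suc m"
      "\<And>j. 0 \<le> 2 ^ Suc m * x $ j - real (b' j)" "\<And>j. 2 ^ Suc m * x $ j - real (b' j) \<le> real N"
      and d: "\<bar>window_interp r f m b x - window_interp r f (Suc m) b' x\<bar> \<le> C * \<psi> (Suc m)"
      unfolding C_def
      by (rule window_interp_refine[of r f m "\<psi> (Suc m)" N L b x]) (use Suc.prems assms in auto)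
    have "\<bar>f x - window_interp r f (Suc m) b' x\<bar> \<le> C * (\<Sum>k<p. \<psi> (Suc (Suc m) + k)) + \<delta>"
      by (rule Suc.IH) (use Suc.prems b' in auto)
    with d have "\<bar>f x - window_interp r f m b x\<bar>
        \<le> C * \<psi> (Suc m) + (C * (\<Sum>k<p. \<psi> (Suc (Suc m) + k)) + \<delta>)"
      by linarith
    then show ?case
      by (simp add: sum.lessThan_Suc_shift distrib_left del: sum.lessThan_Suc)
  qed
  have "summable (\<lambda>k. \<psi> (n + k))"
    using summable_ignore_initial_segment[OF \<psi>(2), of n] by (simp add: add.commute)
  have "\<bar>f x - window_interp r f n b x\<bar> \<le> C * (\<Sum>k<M. \<psi> (Suc n + k)) + \<delta>"
    by (rule chain) (use b x in auto)
  \<comment> \<open>Refinement only involves levels above \<open>n\<close>; adding the nonnegative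
    term of level \<open>n\<close> gives a partial sum of the series in the claim.\<close>
  also have "(\<Sum>k<M. \<psi> (Suc n + k)) \<le> \<psi> n + (\<Sum>k<M. \<psi> (Suc n + k))"
    using \<psi>(1)[of n] by simp
  also have "\<dots> = (\<Sum>k<Suc M. \<psi> (n + k))"
    by (simp add: sum.lessThan_Suc_shift del: sum.lessThan_Suc)
  also have "\<dots> \<le> (\<Sum>k. \<psi> (n + k))"
    by (rule sum_le_suminf) (use \<open>summable (\<lambda>k. \<psi> (n + k))\<close> \<psi>(1) in auto)
  finally show "\<bar>f x - window_interp r f n b x\<bar> \<le> C * (\<Sum>k. \<psi> (n + k)) + \<delta>"
    using \<open>C \<ge> 0\<close> by (simp add: mult_left_mono)
qed

section \<open>From windows to pure differences\<close>

lemma summable_shift_nat: "summable \<psi> \<Longrightarrow> summable (\<lambda>k. \<psi> (n + k))" for \<psi> :: "nat \<Rightarrow> real"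
  using summable_ignore_initial_segment[of \<psi> n] by (simp add: add.commute)

lemma suminf_tail_mono:
  fixes \<psi> :: "nat \<Rightarrow> real"
  assumes "\<And>m. \<psi> m \<ge> 0" "summable \<psi>" "n \<le> m"
  shows "(\<Sum>k. \<psi> (m + k)) \<le> (\<Sum>k. \<psi> (n + k))"
proof -
  have "(\<Sum>k. \<psi> (n + k)) = (\<Sum>k. \<psi> (n + (k + (m - n)))) + (\<Sum>k<m - n. \<psi> (n + k))"
    by (rule suminf_split_initial_segment) (rule summable_shift_nat[OF assms(2)])
  also have "(\<lambda>k. \<psi> (n + (k + (m - n)))) = (\<lambda>k. \<psi> (m + k))"
    using \<open>n \<le> m\<close> by (auto intro!: arg_cong[where f = \<psi>])
  finally show ?thesis using assms(1) by (simp add: sum_nonneg)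
qed

text \<open>The corner is \<open>u\<close> rounded down to the grid, or \<open>2 ^ m - N\<close> if
  that window would leave the cube. The extra step in the condition on \<open>v\<close> pays for the
  rounding.\<close>

lemma window_exists:
  assumes "0 \<le> u" "u \<le> 1" "N \<le> 2 ^ m"
  obtains b :: nat where "b + N \<le> 2 ^ m" "real b \<le> 2 ^ m * u"
    "\<And>v. v \<le> 1 \<Longrightarrow> 2 ^ m * (v - u) + 1 \<le> real N \<Longrightarrow> 2 ^ m * v - real b \<le> real N"
proof (cases "nat \<lfloor>2 ^ m * u\<rfloor> + N \<le> 2 ^ m")
  case True
  have "real (nat \<lfloor>2 ^ m * u\<rfloor>) \<le> 2 ^ m * u" "2 ^ m * u < real (nat \<lfloor>2 ^ m * u\<rfloor>) + 1"
    using assms by (simp_all add: of_nat_nat)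
  then show ?thesis
    using True by (intro that[of "nat \<lfloor>2 ^ m * u\<rfloor>"]) (unfold right_diff_distrib, linarith+)
next
  case False
  have "real (2 ^ m - N) \<le> 2 ^ m * u"
  proof -
    have "2 ^ m - N \<le> nat \<lfloor>2 ^ m * u\<rfloor>" using False by linarith
    then have "real (2 ^ m - N) \<le> real (nat \<lfloor>2 ^ m * u\<rfloor>)" by (rule of_nat_mono)
    also have "\<dots> \<le> 2 ^ m * u" using \<open>0 \<le> u\<close> by (intro of_nat_floor) auto
    finally show ?thesis .
  qed
  moreover have "2 ^ m * v - real (2 ^ m - N) \<le> real N" if "v \<le> 1" for v
  proof -
    have "2 ^ m * v \<le> 2 ^ m * 1" using that by (intro mult_left_mono) auto
    then show ?thesis using assms by (simp add: of_nat_diff)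
  qed
  ultimately show ?thesis using assms by (intro that[of "2 ^ m - N"]) auto
qed

lemma window_interp_finite_diff:
  "(\<Sum>k\<le>r. (-1) ^ (r - k) * real (r choose k) *
      window_interp r f m b (u + real k *\<^sub>R (t *\<^sub>R axis i 1))) = 0"
proof -
  let ?z = "\<lambda>j. 2 ^ m * u $ j - real (b j)"
  have eq: "(\<lambda>j. 2 ^ m * (u + real k *\<^sub>R (t *\<^sub>R axis i 1)) $ j - real (b j))
      = ?z(i := ?z i + real k * (2 ^ m * t))" for k
    by (auto simp: fun_eq_iff axis_def algebra_simps)
  show ?thesis
    unfolding window_interp_def eq by (rule tensor_interp_finite_diff[where z = ?z])
qed

lemma pure_difference_bound:
  assumes "r \<ge> 1"
  shows "\<exists>C>0. \<forall>(f :: real ^ 'n::finite \<Rightarrow> real) \<psi> n i t u.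
    continuous_on unit_cube f \<longrightarrow> (\<forall>m. 0 \<le> \<psi> m) \<longrightarrow> summable \<psi> \<longrightarrow>
    (\<forall>m>n. discrete_bound r f m (\<psi> m)) \<longrightarrow>
    0 \<le> t \<longrightarrow> t \<le> 1 / 2 ^ n \<longrightarrow> u \<in> unit_cube \<longrightarrow> u + (real r * t) *\<^sub>R axis i 1 \<in> unit_cube \<longrightarrow>
    \<bar>finite_diff r (t *\<^sub>R axis i 1) f u\<bar> \<le> C * (\<Sum>k. \<psi> (n + k))"
proof -
  \<comment> \<open>At least \<open>r + 1\<close>, to hold \<open>r\<close> steps and the rounding
    of the corner, and a power of two, so that at level \<open>r\<close> the window is the whole
    cube.\<close>
  define N where "N = (2::nat) ^ r"
  have rN: "r + 1 \<le> N" using less_exp[of r] by (simp add: N_def Suc_le_eq)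
  obtain L :: real where "L \<ge> 1" and
    L: "\<And>y. 0 \<le> y \<Longrightarrow> y \<le> real (2 * N) \<Longrightarrow> (\<Sum>k<r. \<bar>poly (lagrange_basis r k) y\<bar>) \<le> L"
    using lagrange_bound[of "real (2 * N)" r] by metis
  define C where "C = 2 * (L ^ CARD('n) * (real CARD('n) * L ^ CARD('n) * 2 ^ (r * (2 * N))))"
  have "C > 0" using \<open>L \<ge> 1\<close> by (simp add: C_def)
  have "\<bar>finite_diff r (t *\<^sub>R axis i 1) f u\<bar> \<le> 2 ^ r * C * (\<Sum>k. \<psi> (n + k))"
    if cont: "continuous_on unit_cube f" and \<psi>: "\<And>m. 0 \<le> \<psi> m" "summable \<psi>"
      "\<And>m. m > n \<Longrightarrow> discrete_bound r f m (\<psi> m)"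
      and t: "0 \<le> t" "t \<le> 1 / 2 ^ n"
      and u: "u \<in> unit_cube" "u + (real r * t) *\<^sub>R axis i 1 \<in> unit_cube"
    for f :: "real ^ 'n \<Rightarrow> real" and \<psi> n i t u
  proof -
    \<comment> \<open>A grid of level below \<open>r\<close> has no room for a window of side
      \<open>N\<close>. Starting later is harmless, because the tail from \<open>m\<close> is at
      most the tail from \<open>n\<close>.\<close>
    define m where "m = max n r"
    have "N \<le> 2 ^ m" by (simp add: N_def m_def)
    define P where "P j b \<longleftrightarrow> b + N \<le> 2 ^ m \<and> real b \<le> 2 ^ m * u $ j \<and>
      (\<forall>v. v \<le> 1 \<longrightarrow> 2 ^ m * (v - u $ j) + 1 \<le> real N \<or> N = 2 ^ m \<longrightarrow> 2 ^ m * v - real b \<le> real N)"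
      for j b
    have "\<exists>b. P j b" for j
    proof (cases "N = 2 ^ m")
      case True
      then show ?thesis
        using u by (intro exI[of _ 0]) (auto simp: P_def mem_unit_cube mult_left_le)
    next
      case False
      then show ?thesis
        using u \<open>N \<le> 2 ^ m\<close> window_exists[of "u $ j" N m] unfolding P_def mem_unit_cube by metis
    qed
    then obtain b where "\<And>j. P j (b j)" by metis
    then have b: "b j + N \<le> 2 ^ m" "real (b j) \<le> 2 ^ m * u $ j"
      and v: "\<And>v. v \<le> 1 \<Longrightarrow> 2 ^ m * (v - u $ j) + 1 \<le> real N \<or> N = 2 ^ m \<Longrightarrow> 2 ^ m * v - real (b j) \<le> real N" for j
      by (auto simp: P_def)
    \<comment> \<open>If \<open>n \<le> r\<close>, the window is the cube. Otherwise
      \<open>t\<close> is at most one grid step, so \<open>r\<close> steps and the rounding fit into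
      \<open>N\<close>.\<close>
    have len: "2 ^ m * (real k * t) + 1 \<le> real N \<or> N = 2 ^ m" if "k \<le> r" for k
    proof (cases "n \<le> r")
      case True
      then show ?thesis by (simp add: m_def N_def)
    next
      case False
      then have "2 ^ m * t \<le> 1" using t by (simp add: m_def field_simps)
      then have "2 ^ m * t * real k \<le> 1 * real r"
        using that t by (intro mult_mono) auto
      then show ?thesis using rN by (simp add: mult_ac)
    qed
    have err: "\<bar>f (u + real k *\<^sub>R (t *\<^sub>R axis i 1)) - window_interp r f m b (u + real k *\<^sub>R (t *\<^sub>R axis i 1))\<bar>
        \<le> C * (\<Sum>k. \<psi> (m + k))" if "k \<le> r" for k
      unfolding C_def
    proof (rule window_interp_error[OF cont _ _ \<open>L \<ge> 1\<close> L \<psi>(1,2)])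
      let ?x = "u + real k *\<^sub>R (t *\<^sub>R axis i 1)"
      fix j
      have comp: "?x $ j = (if j = i then u $ j + real k * t else u $ j)"
        by (simp add: axis_def)
      have kt: "0 \<le> real k * t" "real k * t \<le> real r * t"
        using that t by (auto intro: mult_right_mono)
      have ge: "u $ j \<le> ?x $ j" unfolding comp using kt by simp
      have "?x $ j \<le> 1"
      proof (cases "j = i")
        case True
        have "(u + (real r * t) *\<^sub>R axis i 1) $ i \<le> 1" using u unfolding mem_unit_cube by blast
        then show ?thesis unfolding comp using True kt by (simp add: axis_def)
      next
        case False
        then show ?thesis unfolding comp using u by (simp add: mem_unit_cube)
      qed
      moreover have "2 ^ m * (?x $ j - u $ j) + 1 \<le> real N \<or> N = 2 ^ m"
        unfolding comp using len[OF that] rN by (auto split: if_splits)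
      ultimately show "2 ^ m * ?x $ j - real (b j) \<le> real N" by (rule v)
      have "2 ^ m * u $ j \<le> 2 ^ m * ?x $ j" using ge by (intro mult_left_mono) auto
      then show "0 \<le> 2 ^ m * ?x $ j - real (b j)" using b(2)[of j] by linarith
    qed (use assms rN b \<psi>(3) in \<open>auto simp: m_def\<close>)
    have "\<bar>\<Sum>k\<le>r. (-1) ^ (r - k) * real (r choose k) *
        (f (u + real k *\<^sub>R (t *\<^sub>R axis i 1)) - window_interp r f m b (u + real k *\<^sub>R (t *\<^sub>R axis i 1)))\<bar>
        \<le> 2 ^ r * (C * (\<Sum>k. \<psi> (m + k)))"
      using dif_funpow_bound[of r "\<lambda>x. f x - window_interp r f m b x" u "t *\<^sub>R axis i 1"] err
      unfolding dif_funpow_sum by blast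
    then have "\<bar>finite_diff r (t *\<^sub>R axis i 1) f u\<bar> \<le> 2 ^ r * (C * (\<Sum>k. \<psi> (m + k)))"
      using window_interp_finite_diff[of r f m b u t i]
      by (simp add: finite_diff_def right_diff_distrib sum_subtractf)
    also have "\<dots> \<le> 2 ^ r * (C * (\<Sum>k. \<psi> (n + k)))"
      using \<open>C > 0\<close> suminf_tail_mono[of \<psi> n m] \<psi>(1,2) by (simp add: m_def)
    finally show ?thesis by (simp add: mult.assoc)
  qed
  then show ?thesis
    using \<open>C > 0\<close> by (intro exI[of _ "2 ^ r * C"]) auto
qed

section \<open>Mixed differences\<close>

text \<open>An arbitrary enumeration: the coordinate differences commute, so its order does not
  matter. A list supports definition by \<open>foldr\<close>, induction, and the removal of a single
  coordinate.\<close>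

definition coords :: "'n::finite list" where
  "coords = (SOME xs. set xs = UNIV \<and> distinct xs)"

lemma coords: "set (coords :: 'n::finite list) = UNIV" "distinct (coords :: 'n list)"
proof -
  have "\<exists>xs :: 'n list. set xs = UNIV \<and> distinct xs"
    by (rule finite_distinct_list) simp
  from someI_ex[OF this] show "set (coords :: 'n list) = UNIV" "distinct (coords :: 'n list)"
    unfolding coords_def by auto
qed

definition mixed_dif ::
    "'n list \<Rightarrow> ('n \<Rightarrow> nat) \<Rightarrow> ('n \<Rightarrow> real) \<Rightarrow> (real ^ 'n \<Rightarrow> real) \<Rightarrow> real ^ 'n::finite \<Rightarrow> real" where
  "mixed_dif xs \<alpha> h f = foldr (\<lambda>i. dif (h i *\<^sub>R axis i 1) ^^ \<alpha> i) xs f"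

lemma mixed_dif_Nil [simp]: "mixed_dif [] \<alpha> h f = f"
  and mixed_dif_Cons [simp]:
    "mixed_dif (i # xs) \<alpha> h f = (dif (h i *\<^sub>R axis i 1) ^^ \<alpha> i) (mixed_dif xs \<alpha> h f)"
  by (simp_all add: mixed_dif_def)

lemma mixed_dif_commute: "mixed_dif xs \<alpha> h ((dif c ^^ m) f) = (dif c ^^ m) (mixed_dif xs \<alpha> h f)"
  by (induction xs) (simp_all add: dif_funpow_commute[where a = c])

lemma mixed_dif_remove:
  assumes "i \<in> set xs"
  shows "mixed_dif xs \<alpha> h f = (dif (h i *\<^sub>R axis i 1) ^^ \<alpha> i) (mixed_dif (remove1 i xs) \<alpha> h f)"
  using assms
proof (induction xs)
  case (Cons a xs)
  then show ?case
    by (cases "a = i") (simp_all add: dif_funpow_commute[where a = "h i *\<^sub>R axis i 1"])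
qed simp

lemma mixed_dif_cong:
  assumes "\<And>i. i \<in> set xs \<Longrightarrow> \<alpha> i = \<beta> i" "\<And>i. i \<in> set xs \<Longrightarrow> h i = k i"
  shows "mixed_dif xs \<alpha> h f = mixed_dif xs \<beta> k f"
  using assms by (induction xs) simp_all

text \<open>What remains after coordinate \<open>i\<close> is split off does not depend on
  \<open>\<alpha> i\<close> and \<open>h i\<close>, so changing the order or the step in that
  coordinate acts on one fixed function.\<close>

lemma mixed_dif_coords:
  "mixed_dif coords (\<alpha>(i := a)) (h(i := c)) f
    = (dif (c *\<^sub>R axis i 1) ^^ a) (mixed_dif (remove1 i coords) \<alpha> h f)"
proof -
  have "mixed_dif (remove1 i coords) (\<alpha>(i := a)) (h(i := c)) f = mixed_dif (remove1 i coords) \<alpha> h f"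
    by (intro mixed_dif_cong) (auto simp: set_remove1_eq coords)
  then show ?thesis
    using mixed_dif_remove[of i coords "\<alpha>(i := a)" "h(i := c)" f] by (simp add: coords)
qed

lemma unit_segment:
  fixes x h :: real
  assumes "0 \<le> x" "x \<le> 1" "0 \<le> x + real a * h" "x + real a * h \<le> 1" "k \<le> a"
  shows "0 \<le> x + real k * h \<and> x + real k * h \<le> 1"
proof (cases "h \<ge> 0")
  case True
  then have "0 \<le> real k * h" "real k * h \<le> real a * h"
    using assms by (auto intro: mult_right_mono)
  then show ?thesis using assms by linarith
next
  case False
  then have "0 \<ge> real k * h" "real k * h \<ge> real a * h"
    using assms by (auto simp: mult_nonneg_nonpos intro: mult_right_mono_neg)
  then show ?thesis using assms by linarith
qed

text \<open>Unfolding one coordinate moves the point in that coordinate only. The bound on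
  \<open>g\<close> is asked for only at points that agree with \<open>x\<close> outside
  \<open>xs\<close>, so \<open>g\<close> may itself be a difference in a coordinate outside the
  list.\<close>

lemma mixed_dif_bound:
  assumes "distinct xs"
    and "\<And>j. j \<in> set xs \<Longrightarrow> 0 \<le> x $ j \<and> x $ j \<le> 1 \<and>
      0 \<le> x $ j + real (\<alpha> j) * h j \<and> x $ j + real (\<alpha> j) * h j \<le> 1"
    and "\<And>y. (\<And>j. j \<in> set xs \<Longrightarrow> 0 \<le> y $ j \<and> y $ j \<le> 1) \<Longrightarrow>
      (\<And>j. j \<notin> set xs \<Longrightarrow> y $ j = x $ j) \<Longrightarrow> \<bar>g y\<bar> \<le> c"
  shows "\<bar>mixed_dif xs \<alpha> h g x\<bar> \<le> 2 ^ (\<Sum>j\<in>set xs. \<alpha> j) * c"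
  using assms
proof (induction xs arbitrary: x)
  case Nil
  then show ?case by simp
next
  case (Cons a xs)
  have "\<bar>(dif (h a *\<^sub>R axis a 1) ^^ \<alpha> a) (mixed_dif xs \<alpha> h g) x\<bar>
      \<le> 2 ^ \<alpha> a * (2 ^ (\<Sum>j\<in>set xs. \<alpha> j) * c)"
  proof (rule dif_funpow_bound, rule Cons.IH)
    fix k assume k: "k \<le> \<alpha> a"
    let ?x = "x + real k *\<^sub>R (h a *\<^sub>R axis a 1)"
    have other: "?x $ j = x $ j" if "j \<noteq> a" for j
      using that by (simp add: axis_def)
    have xa: "0 \<le> ?x $ a \<and> ?x $ a \<le> 1"
      using unit_segment[of "x $ a" "\<alpha> a" "h a" k] Cons.prems(2)[of a] k by (simp add: axis_def)
    show "distinct xs" using Cons.prems by simp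
    show "0 \<le> ?x $ j \<and> ?x $ j \<le> 1 \<and> 0 \<le> ?x $ j + real (\<alpha> j) * h j \<and> ?x $ j + real (\<alpha> j) * h j \<le> 1"
      if "j \<in> set xs" for j
    proof -
      have "j \<noteq> a" using that Cons.prems by auto
      then show ?thesis unfolding other[OF \<open>j \<noteq> a\<close>] using that Cons.prems(2)[of j] by simp
    qed
    fix y assume y: "\<And>j. j \<in> set xs \<Longrightarrow> 0 \<le> y $ j \<and> y $ j \<le> 1" "\<And>j. j \<notin> set xs \<Longrightarrow> y $ j = ?x $ j"
    show "\<bar>g y\<bar> \<le> c"
    proof (rule Cons.prems(3))
      fix j
      show "0 \<le> y $ j \<and> y $ j \<le> 1" if "j \<in> set (a # xs)"
        using y[of j] xa that by (cases "j \<in> set xs") auto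
      show "y $ j = x $ j" if "j \<notin> set (a # xs)"
        using y(2)[of j] other[of j] that by simp
    qed
  qed
  then show ?case using Cons.prems by (simp add: power_add mult.assoc)
qed

text \<open>The opposite corners of the box spanned by the mixed difference lie in the cube, and by
  convexity so do all points at which it evaluates the function. Steps of either sign are
  allowed.\<close>

definition fits :: "('n \<Rightarrow> nat) \<Rightarrow> ('n \<Rightarrow> real) \<Rightarrow> real ^ 'n::finite \<Rightarrow> bool" where
  "fits \<alpha> h x \<longleftrightarrow> (\<forall>j. 0 \<le> x $ j \<and> x $ j \<le> 1 \<and>
      0 \<le> x $ j + real (\<alpha> j) * h j \<and> x $ j + real (\<alpha> j) * h j \<le> 1)"

lemma mixed_dif_sup_bound:
  assumes "fits \<alpha> h x" and "\<And>y. y \<in> unit_cube \<Longrightarrow> \<bar>f y\<bar> \<le> F"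
  shows "\<bar>mixed_dif coords \<alpha> h f x\<bar> \<le> 2 ^ sum \<alpha> UNIV * F"
  using mixed_dif_bound[of coords x \<alpha> h f F] assms by (auto simp: fits_def mem_unit_cube coords)

text \<open>Since differences commute, the pure difference of order \<open>r\<close> can be applied
  to \<open>f\<close> innermost; each further order costs at most a factor 2.\<close>

lemma mixed_dif_pure_bound:
  fixes f :: "real ^ 'n::finite \<Rightarrow> real"
  assumes "fits \<alpha> h x" "\<alpha> i = r" "w \<ge> 0"
    and w: "\<And>u. u \<in> unit_cube \<Longrightarrow> u + (real r * h i) *\<^sub>R axis i 1 \<in> unit_cube \<Longrightarrow>
      \<bar>finite_diff r (h i *\<^sub>R axis i 1) f u\<bar> \<le> w"
  shows "\<bar>mixed_dif coords \<alpha> h f x\<bar> \<le> 2 ^ sum \<alpha> UNIV * w"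
proof -
  let ?ys = "remove1 i coords :: 'n list"
  have ys: "set ?ys = UNIV - {i}" "distinct ?ys"
    by (auto simp: set_remove1_eq coords)
  have "mixed_dif coords \<alpha> h f = mixed_dif ?ys \<alpha> h ((dif (h i *\<^sub>R axis i 1) ^^ r) f)"
    using mixed_dif_remove[of i coords \<alpha> h f] assms(2) by (simp add: mixed_dif_commute coords)
  moreover have "\<bar>mixed_dif ?ys \<alpha> h ((dif (h i *\<^sub>R axis i 1) ^^ r) f) x\<bar> \<le> 2 ^ (\<Sum>j\<in>set ?ys. \<alpha> j) * w"
  proof (rule mixed_dif_bound[OF ys(2)])
    fix y :: "real ^ 'n"
    assume y: "\<And>j. j \<in> set ?ys \<Longrightarrow> 0 \<le> y $ j \<and> y $ j \<le> 1" "\<And>j. j \<notin> set ?ys \<Longrightarrow> y $ j = x $ j"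
    have "0 \<le> y $ j \<and> y $ j \<le> 1" for j
      using y[of j] assms(1) unfolding fits_def ys by (cases "j = i") auto
    moreover have "0 \<le> (y + (real r * h i) *\<^sub>R axis i 1) $ j \<and> (y + (real r * h i) *\<^sub>R axis i 1) $ j \<le> 1" for j
      using y[of j] assms(1,2) unfolding fits_def ys by (cases "j = i") (auto simp: axis_def)
    ultimately show "\<bar>(dif (h i *\<^sub>R axis i 1) ^^ r) f y\<bar> \<le> w"
      using w[of y] by (simp add: finite_diff_eq_dif mem_unit_cube)
  qed (use assms(1) in \<open>auto simp: fits_def\<close>)
  moreover have "(2::real) ^ (\<Sum>j\<in>set ?ys. \<alpha> j) * w \<le> 2 ^ sum \<alpha> UNIV * w"
    using \<open>w \<ge> 0\<close> by (intro mult_right_mono power_increasing sum_mono2) auto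
  ultimately show ?thesis by simp
qed

text \<open>The doubled step could leave the cube. Reversing the direction if necessary puts the base point
  into the half of the unit interval from which the step points inwards.\<close>
lemma mixed_dif_double_coord:
  fixes f :: "real ^ 'n::finite \<Rightarrow> real"
  assumes fits: "fits \<alpha> h x" and t: "\<bar>h i\<bar> \<le> t" "4 * real r * t \<le> 1" and "\<alpha> i \<le> r"
    and K: "\<And>h' x'. (\<And>j. j \<noteq> i \<Longrightarrow> h' j = h j) \<Longrightarrow> \<bar>h' i\<bar> \<le> t \<Longrightarrow> fits (\<alpha>(i := Suc (\<alpha> i))) h' x' \<Longrightarrow>
      \<bar>mixed_dif coords (\<alpha>(i := Suc (\<alpha> i))) h' f x'\<bar> \<le> K"
  obtains c x' where "\<bar>c\<bar> \<le> 2 * t" "fits \<alpha> (h(i := c)) x'"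
    "\<bar>mixed_dif coords \<alpha> h f x\<bar> \<le> \<bar>mixed_dif coords \<alpha> (h(i := c)) f x'\<bar> / 2 ^ \<alpha> i + real (\<alpha> i) / 2 * K"
proof -
  define a where "a = \<alpha> i"
  define G where "G = mixed_dif (remove1 i coords) \<alpha> h f"
  have G: "mixed_dif coords (\<alpha>(i := b)) (h(i := c)) f = (dif (c *\<^sub>R axis i 1) ^^ b) G" for b c
    by (simp add: G_def mixed_dif_coords)
  \<comment> \<open>From the half interval in which the step points inwards, a total displacement of
    at most 1/2 stays inside the unit interval.\<close>
  have small: "real (2 * a) * \<bar>h i\<bar> \<le> 1 / 2"
  proof -
    have "real a * \<bar>h i\<bar> \<le> real r * t"
      using t(1) \<open>\<alpha> i \<le> r\<close> by (intro mult_mono) (auto simp: a_def)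
    then show ?thesis using t(2) by simp
  qed
  obtain c x0 where c: "\<bar>c\<bar> = \<bar>h i\<bar>"
    and x0: "\<And>j. j \<noteq> i \<Longrightarrow> x0 $ j = x $ j"
    and good: "0 \<le> x0 $ i" "x0 $ i \<le> 1" "0 < c \<Longrightarrow> x0 $ i \<le> 1 / 2" "c < 0 \<Longrightarrow> 1 / 2 \<le> x0 $ i"
    and eq: "\<bar>mixed_dif coords \<alpha> h f x\<bar> = \<bar>(dif (c *\<^sub>R axis i 1) ^^ a) G x0\<bar>"
  proof (cases "(0 < h i \<longrightarrow> x $ i \<le> 1 / 2) \<and> (h i < 0 \<longrightarrow> 1 / 2 \<le> x $ i)")
    case True
    show ?thesis
      by (rule that[of "h i" x]) (use True fits G[of a "h i"] in \<open>auto simp: fits_def a_def split: if_splits\<close>)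
  next
    case False
    let ?x = "x + real a *\<^sub>R (h i *\<^sub>R axis i 1)"
    have xi: "?x $ i = x $ i + real (\<alpha> i) * h i" by (simp add: axis_def a_def)
    have sg: "h i \<ge> 0 \<Longrightarrow> real (\<alpha> i) * h i \<ge> 0" "h i < 0 \<Longrightarrow> real (\<alpha> i) * h i \<le> 0"
      by (auto simp: mult_nonneg_nonpos)
    have fi: "0 \<le> x $ i + real (\<alpha> i) * h i" "x $ i + real (\<alpha> i) * h i \<le> 1"
      using fits by (auto simp: fits_def)
    have hp: "1 / 2 \<le> ?x $ i" if "0 < h i"
    proof -
      have "1 / 2 \<le> x $ i" using False that by auto
      then show ?thesis unfolding xi using sg(1) that by linarith
    qed
    have hn: "?x $ i \<le> 1 / 2" if "h i < 0"
    proof -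
      have "x $ i \<le> 1 / 2" using False that by auto
      then show ?thesis unfolding xi using sg(2) that by linarith
    qed
    show ?thesis
    proof (rule that[of "- h i" ?x])
      show "\<bar>mixed_dif coords \<alpha> h f x\<bar> = \<bar>(dif (- h i *\<^sub>R axis i 1) ^^ a) G ?x\<bar>"
        using dif_funpow_reverse[where c = "h i *\<^sub>R axis i 1" and r = a and g = G and x = x] G[of a "h i"] by (simp add: a_def)
      show "?x $ j = x $ j" if "j \<noteq> i" for j using that by (simp add: axis_def)
      show "0 \<le> ?x $ i" "?x $ i \<le> 1" unfolding xi by (rule fi)+
    qed (use hp hn in \<open>simp_all only: neg_0_less_iff_less neg_less_0_iff_less abs_minus_cancel\<close>)
  qed
  \<comment> \<open>\<open>2 * a\<close> steps suffice for both terms: the doubled difference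
    reaches exactly that far, and the difference of order \<open>Suc a\<close> based at step
    \<open>k < a\<close> reaches \<open>k + Suc a\<close>.\<close>
  have room: "0 \<le> x0 $ i + real k * c \<and> x0 $ i + real k * c \<le> 1" if "k \<le> 2 * a" for k
  proof -
    have "\<bar>real k * c\<bar> \<le> real (2 * a) * \<bar>h i\<bar>"
      unfolding abs_mult c using that by (intro mult_mono) auto
    then have "\<bar>real k * c\<bar> \<le> 1 / 2" using small by linarith
    moreover have "c \<ge> 0 \<Longrightarrow> real k * c \<ge> 0" "c < 0 \<Longrightarrow> real k * c \<le> 0"
      by (auto simp: mult_nonneg_nonpos)
    ultimately show ?thesis using good by (cases c "0::real" rule: linorder_cases) auto
  qed
  have "\<bar>(dif (c *\<^sub>R axis i 1) ^^ a) G x0\<bar>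
      \<le> \<bar>(dif (2 *\<^sub>R (c *\<^sub>R axis i 1)) ^^ a) G x0\<bar> / 2 ^ a + real a / 2 * K"
  proof (rule dif_funpow_doubling)
    fix k assume k: "k < a"
    let ?x = "x0 + real k *\<^sub>R (c *\<^sub>R axis i 1)"
    have xi: "?x $ i = x0 $ i + real k * c" by (simp add: axis_def)
    have xj: "?x $ j = x $ j" if "j \<noteq> i" for j using x0 that by (simp add: axis_def)
    have "\<bar>mixed_dif coords (\<alpha>(i := Suc (\<alpha> i))) (h(i := c)) f ?x\<bar> \<le> K"
    proof (rule K)
      show "fits (\<alpha>(i := Suc (\<alpha> i))) (h(i := c)) ?x"
        unfolding fits_def
      proof
        fix j
        show "0 \<le> ?x $ j \<and> ?x $ j \<le> 1 \<and> 0 \<le> ?x $ j + real ((\<alpha>(i := Suc (\<alpha> i))) j) * (h(i := c)) j \<and>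
          ?x $ j + real ((\<alpha>(i := Suc (\<alpha> i))) j) * (h(i := c)) j \<le> 1"
        proof (cases "j = i")
          case True
          then show ?thesis
            unfolding True xi using room[of k] room[of "k + Suc a"] k
            by (simp add: a_def algebra_simps)
        next
          case False
          then show ?thesis unfolding xj[OF False] using fits by (simp add: fits_def)
        qed
      qed
    qed (use c t in auto)
    then show "\<bar>(dif (c *\<^sub>R axis i 1) ^^ Suc a) G ?x\<bar> \<le> K"
      unfolding G by (simp add: a_def)
  qed
  then have "\<bar>mixed_dif coords \<alpha> h f x\<bar>
      \<le> \<bar>mixed_dif coords \<alpha> (h(i := 2 * c)) f x0\<bar> / 2 ^ \<alpha> i + real (\<alpha> i) / 2 * K"
    using eq G[of a "2 * c"] by (simp add: a_def)
  moreover have "fits \<alpha> (h(i := 2 * c)) x0"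
    unfolding fits_def
  proof
    fix j
    show "0 \<le> x0 $ j \<and> x0 $ j \<le> 1 \<and> 0 \<le> x0 $ j + real (\<alpha> j) * (h(i := 2 * c)) j \<and>
      x0 $ j + real (\<alpha> j) * (h(i := 2 * c)) j \<le> 1"
      using room[of 0] room[of "2 * a"] fits x0[of j]
      by (cases "j = i") (auto simp: a_def fits_def algebra_simps)
  qed
  ultimately show thesis
    using c t by (intro that[of "2 * c" x0]) auto
qed

text \<open>The cap \<open>\<alpha> j \<le> r\<close> makes the property vacuous for
  \<open>s > CARD('n) * r\<close>, where the downward induction starts. A coordinate that has
  reached order \<open>r\<close> is handled by the pure bound, so no order is raised
  further.\<close>

definition mixed_bounded :: "nat \<Rightarrow> (real ^ 'n::finite \<Rightarrow> real) \<Rightarrow> nat \<Rightarrow> real \<Rightarrow> real \<Rightarrow> bool" where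
  "mixed_bounded r f s t K \<longleftrightarrow> (\<forall>\<alpha> h x. sum \<alpha> UNIV = s \<longrightarrow> (\<forall>j. \<alpha> j \<le> r) \<longrightarrow> (\<forall>j. \<bar>h j\<bar> \<le> t) \<longrightarrow>
    fits \<alpha> h x \<longrightarrow> \<bar>mixed_dif coords \<alpha> h f x\<bar> \<le> K)"

text \<open>The coordinates are doubled in turn, \<open>S\<close> being those already done. The
  gains multiply to \<open>2 ^ s\<close>; each error is a difference of order \<open>Suc s\<close>
  with steps at most \<open>2 * t\<close>, and its prefactor, at most 1, is dropped.
  \<open>\<alpha> j < r\<close> leaves room to raise one order.\<close>

lemma mixed_dif_double:
  fixes f :: "real ^ 'n::finite \<Rightarrow> real"
  assumes fits: "fits \<alpha> h x" and \<alpha>: "sum \<alpha> UNIV = s" "\<And>j. \<alpha> j < r"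
    and t: "\<And>j. \<bar>h j\<bar> \<le> t" "4 * real r * t \<le> 1"
    and K: "mixed_bounded r f s (2 * t) K" "mixed_bounded r f (Suc s) (2 * t) K'" and "K' \<ge> 0"
  shows "\<bar>mixed_dif coords \<alpha> h f x\<bar> \<le> K / 2 ^ s + real s / 2 * K'"
proof -
  have "t \<ge> 0" using t(1)[of undefined] by linarith
  have "\<exists>h' x'. (\<forall>j\<in>S. \<bar>h' j\<bar> \<le> 2 * t) \<and> (\<forall>j. j \<notin> S \<longrightarrow> h' j = h j) \<and> fits \<alpha> h' x' \<and>
      \<bar>mixed_dif coords \<alpha> h f x\<bar> \<le> \<bar>mixed_dif coords \<alpha> h' f x'\<bar> / 2 ^ sum \<alpha> S + real (sum \<alpha> S) / 2 * K'"
    (is "\<exists>h' x'. ?P S h' x'") for S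
  proof -
    have "finite S" by simp
    then show ?thesis
    proof (induction S rule: finite_induct)
      case empty
      then show ?case using fits by (intro exI[of _ h] exI[of _ x]) auto
    next
      case (insert i S)
      then obtain h' x' where h': "\<And>j. j \<in> S \<Longrightarrow> \<bar>h' j\<bar> \<le> 2 * t" "\<And>j. j \<notin> S \<Longrightarrow> h' j = h j"
        and fits': "fits \<alpha> h' x'"
        and IH: "\<bar>mixed_dif coords \<alpha> h f x\<bar>
          \<le> \<bar>mixed_dif coords \<alpha> h' f x'\<bar> / 2 ^ sum \<alpha> S + real (sum \<alpha> S) / 2 * K'"
        by auto
      have h2: "\<bar>h' j\<bar> \<le> 2 * t" for j
        using h'(1)[of j] h'(2)[of j] t(1)[of j] \<open>t \<ge> 0\<close> by (cases "j \<in> S") auto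
      obtain c x'' where c: "\<bar>c\<bar> \<le> 2 * t" "fits \<alpha> (h'(i := c)) x''"
        and step: "\<bar>mixed_dif coords \<alpha> h' f x'\<bar>
          \<le> \<bar>mixed_dif coords \<alpha> (h'(i := c)) f x''\<bar> / 2 ^ \<alpha> i + real (\<alpha> i) / 2 * K'"
      proof (rule mixed_dif_double_coord[OF fits', of i t r f K'])
        show "\<bar>h' i\<bar> \<le> t" using h'(2)[OF insert.hyps(2)] t(1)[of i] by simp
        show "\<alpha> i \<le> r" using \<alpha>(2)[of i] by simp
        fix g y assume g: "\<And>j. j \<noteq> i \<Longrightarrow> g j = h' j" "\<bar>g i\<bar> \<le> t" "fits (\<alpha>(i := Suc (\<alpha> i))) g y"
        have "sum (\<alpha>(i := Suc (\<alpha> i))) UNIV = Suc s"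
          using sum.remove[of UNIV i \<alpha>] sum.remove[of UNIV i "\<alpha>(i := Suc (\<alpha> i))"] \<alpha>(1) by simp
        moreover have "(\<alpha>(i := Suc (\<alpha> i))) j \<le> r" for j
          using \<alpha>(2)[of j] by auto
        moreover have "\<bar>g j\<bar> \<le> 2 * t" for j
          using g(1)[of j] g(2) h2[of j] \<open>t \<ge> 0\<close> by (cases "j = i") auto
        ultimately show "\<bar>mixed_dif coords (\<alpha>(i := Suc (\<alpha> i))) g f y\<bar> \<le> K'"
          using K(2) g(3) unfolding mixed_bounded_def by blast
      qed (use t in auto)
      have "\<bar>mixed_dif coords \<alpha> h' f x'\<bar> / 2 ^ sum \<alpha> S
          \<le> (\<bar>mixed_dif coords \<alpha> (h'(i := c)) f x''\<bar> / 2 ^ \<alpha> i + real (\<alpha> i) / 2 * K') / 2 ^ sum \<alpha> S"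
        using step by (rule divide_right_mono) simp
      also have "\<dots> = \<bar>mixed_dif coords \<alpha> (h'(i := c)) f x''\<bar> / 2 ^ sum \<alpha> (insert i S)
          + (real (\<alpha> i) / 2 * K') / 2 ^ sum \<alpha> S"
        using insert.hyps by (simp add: add_divide_distrib power_add)
      also have "(real (\<alpha> i) / 2 * K') / 2 ^ sum \<alpha> S \<le> (real (\<alpha> i) / 2 * K') / 1"
        using \<open>K' \<ge> 0\<close> by (intro divide_left_mono) auto
      finally have "\<bar>mixed_dif coords \<alpha> h' f x'\<bar> / 2 ^ sum \<alpha> S
          \<le> \<bar>mixed_dif coords \<alpha> (h'(i := c)) f x''\<bar> / 2 ^ sum \<alpha> (insert i S) + real (\<alpha> i) / 2 * K'"
        by (simp only: div_by_1)
      moreover have "real (sum \<alpha> (insert i S)) / 2 * K' = real (\<alpha> i) / 2 * K' + real (sum \<alpha> S) / 2 * K'"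
        using insert.hyps by (simp add: algebra_simps add_divide_distrib)
      ultimately have "\<bar>mixed_dif coords \<alpha> h f x\<bar>
          \<le> \<bar>mixed_dif coords \<alpha> (h'(i := c)) f x''\<bar> / 2 ^ sum \<alpha> (insert i S)
            + real (sum \<alpha> (insert i S)) / 2 * K'"
        using IH by linarith
      moreover have "\<forall>j\<in>insert i S. \<bar>(h'(i := c)) j\<bar> \<le> 2 * t"
        "\<forall>j. j \<notin> insert i S \<longrightarrow> (h'(i := c)) j = h j"
        using c(1) h'(2) h2 by auto
      ultimately show ?case using c(2) by blast
    qed
  qed
  from this[of UNIV] obtain h' x' where h': "\<And>j. \<bar>h' j\<bar> \<le> 2 * t" "fits \<alpha> h' x'"
    and le: "\<bar>mixed_dif coords \<alpha> h f x\<bar> \<le> \<bar>mixed_dif coords \<alpha> h' f x'\<bar> / 2 ^ s + real s / 2 * K'"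
    using \<alpha>(1) by auto
  have "\<bar>mixed_dif coords \<alpha> h' f x'\<bar> \<le> K"
  proof -
    have "\<forall>j. \<alpha> j \<le> r" using \<alpha>(2) less_imp_le by blast
    then show ?thesis using K(1) h' \<alpha>(1) unfolding mixed_bounded_def by blast
  qed
  then have "\<bar>mixed_dif coords \<alpha> h' f x'\<bar> / 2 ^ s \<le> K / 2 ^ s"
    by (rule divide_right_mono) simp
  then show ?thesis using le by linarith
qed

section \<open>A Marchaud inequality\<close>

lemma mixed_bounded_mono:
  fixes f :: "real ^ 'n::finite \<Rightarrow> real"
  assumes "mixed_bounded r f s t K" "K \<le> K'"
  shows "mixed_bounded r f s t K'"
  unfolding mixed_bounded_def
proof (intro allI impI)
  fix \<alpha> h and x :: "real ^ 'n"
  assume "sum \<alpha> UNIV = s" "\<forall>j. \<alpha> j \<le> r" "\<forall>j. \<bar>h j\<bar> \<le> t" "fits \<alpha> h x"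
  then have "\<bar>mixed_dif coords \<alpha> h f x\<bar> \<le> K"
    using assms(1) unfolding mixed_bounded_def by blast
  then show "\<bar>mixed_dif coords \<alpha> h f x\<bar> \<le> K'"
    using assms(2) by (rule order.trans)
qed

text \<open>Either some coordinate has reached order \<open>r\<close> and the pure bound applies, or
  every order can still be raised and the steps are doubled. The sum of both bounds covers the two
  cases.\<close>

lemma mixed_bounded_recursion:
  fixes f :: "real ^ 'n::finite \<Rightarrow> real"
  assumes t: "4 * real r * t \<le> 1" and "w \<ge> 0" "K \<ge> 0" "K' \<ge> 0"
    and w: "\<And>i \<tau> u. \<bar>\<tau>\<bar> \<le> t \<Longrightarrow> u \<in> unit_cube \<Longrightarrow> u + (real r * \<tau>) *\<^sub>R axis i 1 \<in> unit_cube \<Longrightarrow>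
      \<bar>finite_diff r (\<tau> *\<^sub>R axis i 1) f u\<bar> \<le> w"
    and K: "mixed_bounded r f s (2 * t) K" "mixed_bounded r f (Suc s) (2 * t) K'"
  shows "mixed_bounded r f s t (2 ^ s * w + K / 2 ^ s + real s / 2 * K')"
  unfolding mixed_bounded_def
proof (intro allI impI)
  fix \<alpha> h and x :: "real ^ 'n"
  assume \<alpha>: "sum \<alpha> UNIV = s" "\<forall>j. \<alpha> j \<le> r" and h: "\<forall>j. \<bar>h j\<bar> \<le> t" and fits: "fits \<alpha> h x"
  have nonneg: "0 \<le> 2 ^ s * w" "0 \<le> K / 2 ^ s" "0 \<le> real s / 2 * K'"
    using assms by auto
  show "\<bar>mixed_dif coords \<alpha> h f x\<bar> \<le> 2 ^ s * w + K / 2 ^ s + real s / 2 * K'"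
  proof (cases "\<exists>i. \<alpha> i = r")
    case True
    then obtain i where i: "\<alpha> i = r" ..
    have "\<bar>mixed_dif coords \<alpha> h f x\<bar> \<le> 2 ^ sum \<alpha> UNIV * w"
      by (rule mixed_dif_pure_bound[where i = i, OF fits i \<open>w \<ge> 0\<close>]) (use w h in auto)
    then show ?thesis unfolding \<alpha>(1) using nonneg by linarith
  next
    case False
    then have "\<alpha> j < r" for j using \<alpha>(2) by (simp add: less_le)
    then have "\<bar>mixed_dif coords \<alpha> h f x\<bar> \<le> K / 2 ^ s + real s / 2 * K'"
      by (intro mixed_dif_double[OF fits \<alpha>(1) _ _ t K \<open>K' \<ge> 0\<close>]) (use h in auto)
    then show ?thesis using nonneg by linarith
  qed
qed

text \<open>Closed form of the recursion with start \<open>w 0 + F\<close> in which each level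
  divides by \<open>2 ^ s\<close> and adds the next \<open>w\<close>: every doubling contracts, the
  pure differences met on the way enter, and the sup norm \<open>F\<close> is left over at level
  0.\<close>

definition marchaud_sum :: "(nat \<Rightarrow> real) \<Rightarrow> real \<Rightarrow> nat \<Rightarrow> nat \<Rightarrow> real" where
  "marchaud_sum w F s m = (\<Sum>j\<le>m. (1 / 2 ^ s) ^ (m - j) * w j) + (1 / 2 ^ s) ^ m * F"

lemma marchaud_sum_0 [simp]: "marchaud_sum w F s 0 = w 0 + F"
  by (simp add: marchaud_sum_def)

lemma marchaud_sum_Suc: "marchaud_sum w F s (Suc m) = marchaud_sum w F s m / 2 ^ s + w (Suc m)"
proof -
  have "(\<Sum>j\<le>m. (1 / 2 ^ s) ^ (Suc m - j) * w j) = (\<Sum>j\<le>m. (1 / 2 ^ s) ^ (m - j) * w j) / 2 ^ s"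
    unfolding sum_divide_distrib by (intro sum.cong) (auto simp: Suc_diff_le)
  then show ?thesis
    by (simp add: marchaud_sum_def add_divide_distrib)
qed

lemma marchaud_sum_nonneg:
  assumes "\<And>j. w j \<ge> 0" "F \<ge> 0"
  shows "marchaud_sum w F s m \<ge> 0"
  unfolding marchaud_sum_def using assms by (intro add_nonneg_nonneg sum_nonneg mult_nonneg_nonneg) auto

lemma marchaud_sum_antimono:
  assumes "\<And>j. w j \<ge> 0" "F \<ge> 0"
  shows "marchaud_sum w F (Suc s) m \<le> marchaud_sum w F s m"
proof (induction m)
  case (Suc m)
  have "marchaud_sum w F (Suc s) m / 2 ^ Suc s \<le> marchaud_sum w F (Suc s) m / 2 ^ s"
    using marchaud_sum_nonneg[OF assms] by (intro divide_left_mono) auto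
  also have "\<dots> \<le> marchaud_sum w F s m / 2 ^ s"
    using Suc by (rule divide_right_mono) simp
  finally show ?case by (simp add: marchaud_sum_Suc)
qed simp

text \<open>The induction on \<open>m\<close> closes for the combination \<open>2 S\<^sub>s - S\<^sub>s\<^sub>+\<^sub>1\<close> of Marchaud sums, since
  its defect under the recursion dominates \<open>w (m + 1) + 2\<^sup>-\<^sup>s\<^sup>-\<^sup>1 S\<^sub>s\<^sub>+\<^sub>1\<close>.\<close>
lemma mixed_bounded_marchaud_step:
  fixes f :: "real ^ 'n::finite \<Rightarrow> real"
  assumes w0: "\<And>m. w m \<ge> 0" and F: "\<And>x. x \<in> unit_cube \<Longrightarrow> \<bar>f x\<bar> \<le> F" "F \<ge> 0"
    and w: "\<And>m i \<tau> u. \<bar>\<tau>\<bar> \<le> 1 / 2 ^ m \<Longrightarrow> u \<in> unit_cube \<Longrightarrow>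
      u + (real r * \<tau>) *\<^sub>R axis i 1 \<in> unit_cube \<Longrightarrow> \<bar>finite_diff r (\<tau> *\<^sub>R axis i 1) f u\<bar> \<le> w m"
    and m0: "4 * r \<le> 2 ^ m0"
    and D: "D \<ge> 0" "\<And>m. mixed_bounded r f (Suc s) (1 / 2 ^ m) (D * marchaud_sum w F (Suc s) m)"
    and C: "C \<ge> 2 ^ s * 2 ^ (s * m0)" "C \<ge> real s * 2 ^ s * D"
  shows "mixed_bounded r f s (1 / 2 ^ m) (C * (2 * marchaud_sum w F s m - marchaud_sum w F (Suc s) m))"
proof -
  define S where "S = marchaud_sum w F s"
  define S' where "S' = marchaud_sum w F (Suc s)"
  have nn: "S m \<ge> 0" "S' m \<ge> 0" "S' m \<le> S m" for m
    using marchaud_sum_nonneg[OF w0 F(2)] marchaud_sum_antimono[OF w0 F(2)] by (auto simp: S_def S'_def)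
  have C1: "2 ^ s \<le> C"
  proof -
    have "(2::real) ^ s * 1 \<le> 2 ^ s * 2 ^ (s * m0)" by (intro mult_left_mono) auto
    then show ?thesis using C(1) by linarith
  qed
  then have C0: "C \<ge> 0" by (rule order.trans[rotated]) simp
  \<comment> \<open>On the levels up to \<open>m0\<close> the steps may be too long for doubling.
    The sup norm suffices there, because \<open>F\<close> is at most \<open>2 ^ (s * m0)\<close>
    times the Marchaud sum; this is the origin of the first lower bound on \<open>C\<close>.\<close>
  have small: "mixed_bounded r f s (1 / 2 ^ m) (C * (2 * S m - S' m))" if "m \<le> m0" for m
  proof -
    have "mixed_bounded r f s (1 / 2 ^ m) (2 ^ s * F)"
      unfolding mixed_bounded_def
    proof (intro allI impI)
      fix \<alpha> h and x :: "real ^ 'n"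
      assume "sum \<alpha> UNIV = s" "fits \<alpha> h x"
      then show "\<bar>mixed_dif coords \<alpha> h f x\<bar> \<le> 2 ^ s * F"
        using mixed_dif_sup_bound[of \<alpha> h x f F] F(1) by auto
    qed
    moreover have "2 ^ s * F \<le> C * (2 * S m - S' m)"
    proof -
      have "(1 / 2 ^ s) ^ m * F \<le> S m"
        unfolding S_def marchaud_sum_def using w0 by (simp add: sum_nonneg)
      then have "F / 2 ^ (s * m) \<le> S m"
        by (simp add: power_divide power_mult)
      then have "F \<le> 2 ^ (s * m) * S m"
        by (simp add: divide_le_eq mult.commute)
      also have "\<dots> \<le> 2 ^ (s * m0) * S m"
        using that nn by (intro mult_right_mono power_increasing) auto
      finally have "2 ^ s * F \<le> 2 ^ s * 2 ^ (s * m0) * S m"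
        by (simp add: mult.assoc)
      also have "\<dots> \<le> C * (2 * S m - S' m)"
        using C nn[of m] C0 by (intro mult_mono) auto
      finally show ?thesis .
    qed
    ultimately show ?thesis by (rule mixed_bounded_mono)
  qed
  have "mixed_bounded r f s (1 / 2 ^ m) (C * (2 * S m - S' m))" for m
  proof (induction m)
    case 0
    then show ?case by (rule small) simp
  next
    case (Suc m)
    show ?case
    proof (cases "Suc m \<le> m0")
      case True
      then show ?thesis by (rule small)
    next
      case False
      have t2: "2 * (1 / 2 ^ Suc m) = (1 / 2 ^ m :: real)" by simp
      have "mixed_bounded r f s (1 / 2 ^ Suc m)
          (2 ^ s * w (Suc m) + C * (2 * S m - S' m) / 2 ^ s + real s / 2 * (D * S' m))"
      proof (rule mixed_bounded_recursion)
        have "real (4 * r) \<le> real (2 ^ m0)" using m0 by (rule of_nat_mono)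
        also have "real (2 ^ m0) \<le> 2 ^ Suc m" using False by (simp add: power_increasing del: power_Suc)
        finally show "4 * real r * (1 / 2 ^ Suc m) \<le> 1" by (simp add: divide_le_eq)
        show "mixed_bounded r f s (2 * (1 / 2 ^ Suc m)) (C * (2 * S m - S' m))"
          unfolding t2 by (rule Suc.IH)
        show "mixed_bounded r f (Suc s) (2 * (1 / 2 ^ Suc m)) (D * S' m)"
          unfolding t2 S'_def by (rule D)
        show "0 \<le> C * (2 * S m - S' m)" "0 \<le> D * S' m"
          using C0 D(1) nn[of m] by auto
      qed (use w w0 in auto)
      moreover have "2 ^ s * w (Suc m) + C * (2 * S m - S' m) / 2 ^ s + real s / 2 * (D * S' m)
          \<le> C * (2 * S (Suc m) - S' (Suc m))"
      proof -
        have "2 * S (Suc m) - S' (Suc m) = w (Suc m) + (2 * S m - S' m) / 2 ^ s + S' m / 2 ^ Suc s"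
          by (simp add: S_def S'_def marchaud_sum_Suc field_simps)
        then have eq: "C * (2 * S (Suc m) - S' (Suc m))
            = C * w (Suc m) + C * (2 * S m - S' m) / 2 ^ s + C * S' m / 2 ^ Suc s"
          by (simp add: distrib_left)
        have 1: "2 ^ s * w (Suc m) \<le> C * w (Suc m)"
          using C1 w0 by (rule mult_right_mono)
        \<comment> \<open>The surplus \<open>C * S' m / 2 ^ Suc s\<close> has to pay for the
          differences of order \<open>Suc s\<close>, which dictates the second lower bound on
          \<open>C\<close>.\<close>
        have "(real s * 2 ^ s * D) * S' m / 2 ^ Suc s \<le> C * S' m / 2 ^ Suc s"
          using C(2) nn(2)[of m] by (intro divide_right_mono mult_right_mono) auto
        then have 2: "real s / 2 * (D * S' m) \<le> C * S' m / 2 ^ Suc s"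
          by (simp add: mult_ac)
        show ?thesis unfolding eq using 1 2 by linarith
      qed
      ultimately show ?thesis by (rule mixed_bounded_mono)
    qed
  qed
  then show ?thesis by (simp add: S_def S'_def)
qed

text \<open>Downward induction on \<open>s\<close>: for \<open>s\<close> above \<open>d r\<close> the claim is vacuous.\<close>
lemma mixed_bounded_marchaud:
  "\<exists>C\<ge>0. \<forall>(f :: real ^ 'n::finite \<Rightarrow> real) w F m. (\<forall>m. w m \<ge> 0) \<longrightarrow> F \<ge> 0 \<longrightarrow>
      (\<forall>x\<in>unit_cube. \<bar>f x\<bar> \<le> F) \<longrightarrow>
      (\<forall>m i \<tau> u. \<bar>\<tau>\<bar> \<le> 1 / 2 ^ m \<longrightarrow> u \<in> unit_cube \<longrightarrow>
        u + (real r * \<tau>) *\<^sub>R axis i 1 \<in> unit_cube \<longrightarrow> \<bar>finite_diff r (\<tau> *\<^sub>R axis i 1) f u\<bar> \<le> w m) \<longrightarrow>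
      mixed_bounded r f s (1 / 2 ^ m) (C * marchaud_sum w F s m)"
    (is "\<exists>C\<ge>0. ?P s C")
proof -
  let ?N = "Suc (CARD('n) * r)"
  have vac: "\<exists>C\<ge>0. ?P s C" if "s \<ge> ?N" for s
  proof -
    have "\<not> (sum \<alpha> UNIV = s \<and> (\<forall>j. \<alpha> j \<le> r))" for \<alpha> :: "'n \<Rightarrow> nat"
    proof
      assume *: "sum \<alpha> UNIV = s \<and> (\<forall>j. \<alpha> j \<le> r)"
      then have "sum \<alpha> UNIV \<le> (\<Sum>j\<in>(UNIV::'n set). r)" by (intro sum_mono) auto
      then show False using * that by simp
    qed
    then have "?P s 0" unfolding mixed_bounded_def by blast
    then show ?thesis by blast
  qed
  have "\<exists>C\<ge>0. ?P s C" if "s \<le> ?N" for s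
    using that
  proof (induction rule: inc_induct)
    case base
    show ?case by (rule vac) simp
  next
    case (step s)
    then obtain D where D: "D \<ge> 0" "?P (Suc s) D" by blast
    obtain m0 where m0: "4 * r \<le> 2 ^ m0"
      using less_exp[of "4 * r"] by (meson less_imp_le)
    define C where "C = 2 ^ s * 2 ^ (s * m0) + real s * 2 ^ s * D"
    have C: "C \<ge> 2 ^ s * 2 ^ (s * m0)" "C \<ge> real s * 2 ^ s * D" "C \<ge> 0"
      using D(1) by (auto simp: C_def)
    \<comment> \<open>The factor 2 appears when the nonnegative
      \<open>marchaud_sum w F (Suc s) m\<close> is dropped from the combination.\<close>
    have "?P s (2 * C)"
    proof (intro allI impI)
      fix f :: "real ^ 'n \<Rightarrow> real" and w F m
      assume h: "\<forall>m. w m \<ge> 0" "F \<ge> 0" "\<forall>x\<in>unit_cube. \<bar>f x\<bar> \<le> F"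
        "\<forall>m i \<tau> u. \<bar>\<tau>\<bar> \<le> 1 / 2 ^ m \<longrightarrow> u \<in> unit_cube \<longrightarrow>
        u + (real r * \<tau>) *\<^sub>R axis i 1 \<in> unit_cube \<longrightarrow> \<bar>finite_diff r (\<tau> *\<^sub>R axis i 1) f u\<bar> \<le> w m"
      have "mixed_bounded r f (Suc s) (1 / 2 ^ m) (D * marchaud_sum w F (Suc s) m)" for m
        using D(2) h by blast
      then have "mixed_bounded r f s (1 / 2 ^ m)
          (C * (2 * marchaud_sum w F s m - marchaud_sum w F (Suc s) m))"
        using h by (intro mixed_bounded_marchaud_step[OF _ _ _ _ m0 D(1) _ C(1,2)]) auto
      moreover have "C * (2 * marchaud_sum w F s m - marchaud_sum w F (Suc s) m)
          \<le> 2 * C * marchaud_sum w F s m"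
        using C(3) marchaud_sum_nonneg[of w F "Suc s" m] h by (simp add: algebra_simps)
      ultimately show "mixed_bounded r f s (1 / 2 ^ m) (2 * C * marchaud_sum w F s m)"
        by (rule mixed_bounded_mono)
    qed
    then show ?case using C(3) by (intro exI[of _ "2 * C"]) auto
  qed
  then show ?thesis
  proof (cases "s \<le> ?N")
    case False
    then have "s \<ge> ?N" by linarith
    then show ?thesis by (rule vac)
  qed
qed

section \<open>From mixed differences to differences in arbitrary directions\<close>

lemma dif_direction_bound:
  fixes G :: "real ^ 'n::finite \<Rightarrow> real"
  assumes "distinct xs"
    and "\<And>i x'. i \<in> set xs \<Longrightarrow> x' $ i = x $ i \<Longrightarrow>
      (\<And>j. x' $ j = x $ j \<or> j \<in> set xs \<and> x' $ j = x $ j + h j) \<Longrightarrow>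
      \<bar>(dif c ^^ k) (dif (h i *\<^sub>R axis i 1) G) x'\<bar> \<le> K"
  shows "\<bar>(dif c ^^ k) (dif (\<Sum>i\<leftarrow>xs. h i *\<^sub>R axis i 1) G) x\<bar> \<le> real (length xs) * K"
  using assms
proof (induction xs arbitrary: x)
  case Nil
  have "dif 0 G = (\<lambda>x. 0 * G x)" by (auto simp: dif_def)
  then show ?case by (simp only: list.map sum_list.Nil dif_funpow_scale) simp
next
  case (Cons a xs)
  let ?e = "h a *\<^sub>R axis a 1 :: real ^ 'n"
  let ?v = "(\<Sum>i\<leftarrow>xs. h i *\<^sub>R axis i 1) :: real ^ 'n"
  \<comment> \<open>The step is made one coordinate after another. After \<open>?e\<close> only
    coordinate \<open>a\<close> may have moved, so every other coordinate is still at its starting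
    value when its turn comes, as the hypothesis demands.\<close>
  have "dif (?e + ?v) G = (\<lambda>x. dif ?e G x + dif ?v G (x + ?e))"
    by (auto simp: dif_def algebra_simps)
  then have "(dif c ^^ k) (dif (\<Sum>i\<leftarrow>a # xs. h i *\<^sub>R axis i 1) G) x
      = (dif c ^^ k) (dif ?e G) x + (dif c ^^ k) (dif ?v G) (x + ?e)"
    by (simp add: dif_funpow_add dif_funpow_translate)
  moreover have "\<bar>(dif c ^^ k) (dif ?e G) x\<bar> \<le> K"
    by (rule Cons.prems(2)) auto
  moreover have "\<bar>(dif c ^^ k) (dif ?v G) (x + ?e)\<bar> \<le> real (length xs) * K"
  proof (rule Cons.IH)
    fix i x' assume i: "i \<in> set xs" "x' $ i = (x + ?e) $ i"
      and x': "\<And>j. x' $ j = (x + ?e) $ j \<or> j \<in> set xs \<and> x' $ j = (x + ?e) $ j + h j"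
    have e: "(x + ?e) $ j = (if j = a then x $ j + h j else x $ j)" for j
      by (simp add: axis_def)
    have a: "a \<notin> set xs" using Cons.prems(1) by simp
    show "\<bar>(dif c ^^ k) (dif (h i *\<^sub>R axis i 1) G) x'\<bar> \<le> K"
    proof (rule Cons.prems(2))
      show "x' $ i = x $ i" using i a unfolding e by (auto split: if_splits)
      show "x' $ j = x $ j \<or> j \<in> set (a # xs) \<and> x' $ j = x $ j + h j" for j
        using x'[of j] a unfolding e by (auto split: if_splits)
    qed (use i in auto)
  qed (use Cons.prems in auto)
  ultimately show ?case by (simp add: algebra_simps)
qed

text \<open>Each directional difference is traded for \<open>CARD('n)\<close> coordinate
  differences, each of which raises one entry of \<open>\<alpha>\<close> by 1. In coordinate
  \<open>j\<close> the remaining \<open>k\<close> directional steps add up to \<open>k\<close>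
  shifts by \<open>h j\<close>, whence the room \<open>\<alpha> j + k\<close>.\<close>

lemma dif_mixed_bound:
  fixes f :: "real ^ 'n::finite \<Rightarrow> real"
  assumes K: "mixed_bounded r f r t K" and h: "\<And>j. \<bar>h j\<bar> \<le> t"
    and "sum \<alpha> UNIV + k = r" "fits (\<lambda>j. \<alpha> j + k) h x"
  shows "\<bar>(dif (\<Sum>i\<leftarrow>coords. h i *\<^sub>R axis i 1) ^^ k) (mixed_dif coords \<alpha> h f) x\<bar>
    \<le> real CARD('n) ^ k * K"
  using assms(3,4)
proof (induction k arbitrary: \<alpha> x)
  case 0
  have "\<alpha> j \<le> r" for j
    using 0(1) member_le_sum[of j UNIV \<alpha>] by simp
  then show ?case using K h 0 unfolding mixed_bounded_def by simp
next
  case (Suc k)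
  let ?v = "(\<Sum>i\<leftarrow>coords. h i *\<^sub>R axis i 1) :: real ^ 'n"
  have seg: "0 \<le> x $ j + real l * h j \<and> x $ j + real l * h j \<le> 1" if "l \<le> \<alpha> j + Suc k" for j l
    using Suc.prems(2) that by (intro unit_segment[where a = "\<alpha> j + Suc k"]) (auto simp: fits_def)
  have "\<bar>(dif ?v ^^ k) (dif ?v (mixed_dif coords \<alpha> h f)) x\<bar>
      \<le> real (length (coords :: 'n list)) * (real CARD('n) ^ k * K)"
  proof (rule dif_direction_bound[OF coords(2)])
    fix i x' assume i: "x' $ i = x $ i"
      and x': "\<And>j. x' $ j = x $ j \<or> j \<in> set coords \<and> x' $ j = x $ j + h j"
    let ?\<alpha> = "\<alpha>(i := Suc (\<alpha> i))"
    have "mixed_dif coords ?\<alpha> h f = dif (h i *\<^sub>R axis i 1) (mixed_dif coords \<alpha> h f)"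
      using mixed_dif_coords[of \<alpha> i "Suc (\<alpha> i)" h "h i" f] mixed_dif_coords[of \<alpha> i "\<alpha> i" h "h i" f]
      by simp
    moreover have "\<bar>(dif ?v ^^ k) (mixed_dif coords ?\<alpha> h f) x'\<bar> \<le> real CARD('n) ^ k * K"
    proof (rule Suc.IH)
      show "sum ?\<alpha> UNIV + k = r"
        using sum.remove[of UNIV i \<alpha>] sum.remove[of UNIV i ?\<alpha>] Suc.prems(1) by simp
      show "fits (\<lambda>j. ?\<alpha> j + k) h x'"
        unfolding fits_def
      proof
        fix j
        show "0 \<le> x' $ j \<and> x' $ j \<le> 1 \<and> 0 \<le> x' $ j + real (?\<alpha> j + k) * h j \<and>
            x' $ j + real (?\<alpha> j + k) * h j \<le> 1"
        \<comment> \<open>In coordinate \<open>i\<close> the order has grown but the point has not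
          moved. In the others the point may have moved by \<open>h j\<close> while the order is
          unchanged. Either way \<open>\<alpha> j + Suc k\<close> steps from \<open>x\<close>
          suffice.\<close>
        proof (cases "j = i")
          case True
          then show ?thesis
            using i seg[of 0 i] seg[of "\<alpha> i + Suc k" i] by simp
        next
          case False
          consider "x' $ j = x $ j" | "x' $ j = x $ j + h j" using x'[of j] by blast
          then show ?thesis
          proof cases
            case 1
            then show ?thesis using False seg[of 0 j] seg[of "\<alpha> j + k" j] by simp
          next
            case 2
            then show ?thesis using False seg[of 1 j] seg[of "\<alpha> j + Suc k" j]
              by (simp add: algebra_simps)
          qed
        qed
      qed
    qed
    ultimately show "\<bar>(dif ?v ^^ k) (dif (h i *\<^sub>R axis i 1) (mixed_dif coords \<alpha> h f)) x'\<bar>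
        \<le> real CARD('n) ^ k * K" by simp
  qed
  moreover have "length (coords :: 'n list) = CARD('n)"
    using distinct_card[of "coords :: 'n list"] by (simp add: coords)
  ultimately show ?case by (simp add: funpow_swap1 mult.assoc)
qed

lemma finite_diff_mixed_bound:
  fixes f :: "real ^ 'n::finite \<Rightarrow> real"
  assumes K: "mixed_bounded r f r t K" and h: "norm h \<le> t"
    and x: "x \<in> unit_cube" "x + real r *\<^sub>R h \<in> unit_cube"
  shows "\<bar>finite_diff r h f x\<bar> \<le> real CARD('n) ^ r * K"
proof -
  have "(\<Sum>i\<leftarrow>coords. h $ i *\<^sub>R axis i 1) = (\<Sum>i\<in>UNIV. h $ i *\<^sub>R axis i 1)"
    by (simp add: sum_list_distinct_conv_sum_set coords)
  also have "\<dots> = h"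
    using basis_expansion[of h] by (simp add: scalar_mult_eq_scaleR)
  finally have "(\<Sum>i\<leftarrow>coords. h $ i *\<^sub>R axis i 1) = h" .
  moreover have "mixed_dif coords (\<lambda>_. 0) (($) h) f = f"
  proof -
    have "mixed_dif xs (\<lambda>_. 0) (($) h) f = f" for xs by (induction xs) auto
    then show ?thesis .
  qed
  moreover have "\<bar>(dif (\<Sum>i\<leftarrow>coords. h $ i *\<^sub>R axis i 1) ^^ r) (mixed_dif coords (\<lambda>_. 0) (($) h) f) x\<bar>
      \<le> real CARD('n) ^ r * K"
  proof (rule dif_mixed_bound[OF K])
    show "\<bar>h $ j\<bar> \<le> t" for j using component_le_norm_cart[of h j] h by linarith
    show "fits (\<lambda>j. 0 + r) (($) h) x" using x by (auto simp: fits_def mem_unit_cube)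
  qed simp
  ultimately show ?thesis by (simp add: finite_diff_eq_dif)
qed

text \<open>Total order 1 is concentrated in one coordinate, so no doubling occurs and neither
  coarse levels nor the norm of \<open>f\<close> enter. The factor 2 is the
  \<open>2 ^ sum \<alpha> UNIV\<close> of \<open>mixed_dif_pure_bound\<close>.\<close>

lemma mixed_bounded_one:
  fixes f :: "real ^ 'n::finite \<Rightarrow> real"
  assumes "w \<ge> 0"
    and "\<And>i \<tau> u. \<bar>\<tau>\<bar> \<le> t \<Longrightarrow> u \<in> unit_cube \<Longrightarrow> u + \<tau> *\<^sub>R axis i 1 \<in> unit_cube \<Longrightarrow>
      \<bar>finite_diff 1 (\<tau> *\<^sub>R axis i 1) f u\<bar> \<le> w"
  shows "mixed_bounded 1 f 1 t (2 * w)"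
  unfolding mixed_bounded_def
proof (intro allI impI)
  fix \<alpha> h and x :: "real ^ 'n"
  assume \<alpha>: "sum \<alpha> UNIV = 1" "\<forall>j. \<alpha> j \<le> 1" and h: "\<forall>j. \<bar>h j\<bar> \<le> t" and fits: "fits \<alpha> h x"
  have "\<exists>i. \<alpha> i \<noteq> 0"
  proof (rule ccontr)
    assume "\<nexists>i. \<alpha> i \<noteq> 0"
    then show False using \<alpha>(1) by simp
  qed
  then obtain i where "\<alpha> i \<noteq> 0" ..
  then have "\<alpha> i = 1" using \<alpha>(2) by (metis One_nat_def le_Suc_eq le_zero_eq)
  then have "\<bar>mixed_dif coords \<alpha> h f x\<bar> \<le> 2 ^ sum \<alpha> UNIV * w"
    by (intro mixed_dif_pure_bound[where i = i, OF fits _ \<open>w \<ge> 0\<close>]) (use assms(2) h in auto)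
  then show "\<bar>mixed_dif coords \<alpha> h f x\<bar> \<le> 2 * w" using \<alpha>(1) by simp
qed

section \<open>The moduli as real numbers\<close>

lemma cube_segment:
  assumes "x \<in> unit_cube" "x + real r *\<^sub>R h \<in> unit_cube" "k \<le> r"
  shows "x + real k *\<^sub>R h \<in> unit_cube"
  unfolding mem_unit_cube
proof
  fix j
  show "0 \<le> (x + real k *\<^sub>R h) $ j \<and> (x + real k *\<^sub>R h) $ j \<le> 1"
    using unit_segment[of "x $ j" r "h $ j" k] assms by (simp add: mem_unit_cube)
qed

lemma discrete_modulus_ge:
  fixes f :: "real ^ 'n \<Rightarrow> real"
  assumes "\<And>j. b j \<le> 2 ^ m" "b i + r \<le> 2 ^ m"
  shows "ennreal \<bar>finite_diff r ((1 / 2 ^ m) *\<^sub>R axis i 1) f (grid_point m b)\<bar>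
    \<le> discrete_modulus r f (int m)"
proof -
  define \<kappa> :: "int ^ 'n" where "\<kappa> = (\<chi> j. int (b j))"
  have p: "(2::real) powi (- int m) = 1 / 2 ^ m"
    by (simp add: power_int_minus field_simps)
  have g: "(1 / 2 ^ m) *\<^sub>R int_vec \<kappa> = grid_point m b"
    by (simp add: int_vec_def \<kappa>_def grid_point_def vec_eq_iff)
  have g': "(1 / 2 ^ m) *\<^sub>R (int_vec \<kappa> + real r *\<^sub>R axis i 1) = grid_point m (b(i := b i + r))"
    by (auto simp: int_vec_def \<kappa>_def grid_point_def vec_eq_iff axis_def)
  have "grid_point m b \<in> unit_cube" "grid_point m (b(i := b i + r)) \<in> unit_cube"
    using assms by (auto intro!: grid_point_in_cube)
  then show ?thesis
    unfolding discrete_modulus_def p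
    by (intro Sup_upper CollectI exI[of _ i] exI[of _ \<kappa>]) (simp add: g g')
qed

lemma discrete_modulus_le:
  assumes "\<And>x. x \<in> unit_cube \<Longrightarrow> \<bar>f x\<bar> \<le> F"
  shows "discrete_modulus r f m \<le> ennreal (2 ^ r * F)"
  unfolding discrete_modulus_def
proof (rule Sup_least, clarify)
  fix i \<kappa>
  let ?x = "2 powi (- m) *\<^sub>R int_vec \<kappa> :: real ^ 'a" and ?h = "2 powi (- m) *\<^sub>R axis i 1 :: real ^ 'a"
  assume x: "?x \<in> unit_cube" "2 powi (- m) *\<^sub>R (int_vec \<kappa> + real r *\<^sub>R axis i 1) \<in> unit_cube"
  have "2 powi (- m) *\<^sub>R (int_vec \<kappa> + real r *\<^sub>R axis i 1) = ?x + real r *\<^sub>R ?h"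
    by (simp add: scaleR_add_right mult.commute)
  then have "\<bar>finite_diff r ?h f ?x\<bar> \<le> 2 ^ r * F"
    unfolding finite_diff_eq_dif using x cube_segment[of ?x r ?h] assms
    by (intro dif_funpow_bound) auto
  then show "ennreal \<bar>finite_diff r ?h f ?x\<bar> \<le> ennreal (2 ^ r * F)"
    by (rule ennreal_leI)
qed

text \<open>Here \<open>r\<close> steps are longer than the side of the cube, so the supremum runs
  over the empty set. This justifies ending the coarse sum at \<open>level_cutoff\<close>.\<close>

lemma discrete_modulus_eq_0:
  assumes "real r * 2 powi (- m) > 1"
  shows "discrete_modulus r f m = 0"
proof -
  have False if x: "2 powi (- m) *\<^sub>R int_vec \<kappa> \<in> unit_cube"
    "2 powi (- m) *\<^sub>R (int_vec \<kappa> + real r *\<^sub>R axis i 1) \<in> unit_cube" for i \<kappa>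
  proof -
    have "0 \<le> 2 powi (- m) * int_vec \<kappa> $ i"
      using x(1) by (simp add: mem_unit_cube)
    moreover have "2 powi (- m) * (int_vec \<kappa> $ i + real r) \<le> 1"
      using x(2) unfolding mem_unit_cube by (auto simp: axis_def dest: spec[of _ i])
    ultimately show False using assms by (simp add: algebra_simps)
  qed
  then show ?thesis
    unfolding discrete_modulus_def by (auto simp: bot_ennreal[symmetric] intro!: Sup_bot_conv[THEN iffD2])
qed

lemma level_cutoff_ge:
  assumes "r \<ge> 1" "real r * 2 powi (k - int n - 1) \<le> 1"
  shows "k \<le> level_cutoff r n"
proof -
  let ?P = "\<lambda>j::int. real r * 2 powi (j - int n - 1) \<le> 1"
  have bound: "j \<le> int n + 1" if "?P j" for j
  proof (rule ccontr)
    assume "\<not> j \<le> int n + 1"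
    then have "(2::real) powi 1 \<le> 2 powi (j - int n - 1)"
      by (intro power_int_increasing) auto
    then have "1 * 2 \<le> real r * 2 powi (j - int n - 1)"
      using assms(1) by (intro mult_mono) auto
    then show False using that by simp
  qed
  \<comment> \<open>The admissible integers are unbounded below. Cutting them off at
    \<open>k\<close> gives a finite set whose maximum is still the greatest one.\<close>
  define A where "A = {j. k \<le> j \<and> ?P j}"
  have fin: "finite A"
    by (rule finite_subset[of _ "{k..int n + 1}"]) (auto simp: A_def dest: bound)
  have ne: "k \<in> A" using assms by (simp add: A_def)
  have "level_cutoff r n = Max A"
    unfolding level_cutoff_def
  proof (rule Greatest_equality)
    show "?P (Max A)" using Max_in[OF fin] ne by (auto simp: A_def)
    fix j assume j: "?P j"
    show "j \<le> Max A"
    proof (cases "k \<le> j")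
      case True
      then show ?thesis using j fin by (intro Max_ge) (auto simp: A_def)
    next
      case False
      then show ?thesis using Max_ge[OF fin ne] by linarith
    qed
  qed
  then show ?thesis using Max_ge[OF fin ne] by simp
qed

lemma cube_norm_real:
  assumes "continuous_on unit_cube (f :: real ^ 'n \<Rightarrow> real)"
  obtains F where "F \<ge> 0" "\<And>x. x \<in> unit_cube \<Longrightarrow> \<bar>f x\<bar> \<le> F" "cube_norm f = ennreal F"
proof -
  have "compact (unit_cube :: (real ^ 'n) set)" by (simp add: unit_cube_def)
  moreover have "(0 :: real ^ 'n) \<in> unit_cube" by (simp add: mem_unit_cube)
  ultimately obtain x0 where x0: "x0 \<in> unit_cube" "\<And>x. x \<in> unit_cube \<Longrightarrow> \<bar>f x\<bar> \<le> \<bar>f x0\<bar>"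
    using continuous_attains_sup[of unit_cube "\<lambda>x. \<bar>f x\<bar>"] continuous_on_rabs[OF assms] by blast
  have "cube_norm f = ennreal \<bar>f x0\<bar>"
    unfolding cube_norm_def
  proof (rule antisym)
    show "(SUP x\<in>unit_cube. ennreal \<bar>f x\<bar>) \<le> ennreal \<bar>f x0\<bar>"
      using x0 by (intro SUP_least ennreal_leI)
    show "ennreal \<bar>f x0\<bar> \<le> (SUP x\<in>unit_cube. ennreal \<bar>f x\<bar>)"
      using x0 by (intro SUP_upper)
  qed
  then show thesis using that[of "\<bar>f x0\<bar>"] x0 by auto
qed

text \<open>An infinite series makes the estimates trivial; a finite one yields a summable real
  sequence. The terms before \<open>n\<close> are finite as well, because \<open>f\<close> is
  bounded on the cube.\<close>

lemma discrete_modulus_real: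
  fixes f :: "real ^ 'n \<Rightarrow> real"
  assumes F: "\<And>x. x \<in> unit_cube \<Longrightarrow> \<bar>f x\<bar> \<le> F"
    and fin: "(\<Sum>k. discrete_modulus r f (int n + int k)) \<noteq> \<infinity>"
  obtains \<psi> where "\<And>m. 0 \<le> \<psi> m" "summable \<psi>" "\<And>m. discrete_modulus r f (int m) = ennreal (\<psi> m)"
    "\<And>m. discrete_bound r f m (\<psi> m)"
    "(\<Sum>k. discrete_modulus r f (int n + int k)) = ennreal (\<Sum>k. \<psi> (n + k))"
proof -
  define \<psi> where "\<psi> m = enn2real (discrete_modulus r f (int m))" for m
  have \<psi>0: "0 \<le> \<psi> m" for m by (simp add: \<psi>_def)
  have \<psi>: "discrete_modulus r f (int m) = ennreal (\<psi> m)" for m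
  proof -
    have "discrete_modulus r f (int m) < top"
      using discrete_modulus_le[OF F, where r = r and m = "int m"] by (rule le_less_trans) auto
    then show ?thesis by (simp add: \<psi>_def)
  qed
  have shift: "discrete_modulus r f (int n + int k) = ennreal (\<psi> (n + k))" for k
    using \<psi>[of "n + k"] by simp
  have "summable (\<lambda>k. \<psi> (n + k))"
    by (rule summable_suminf_not_top) (use \<psi>0 fin shift in auto)
  then have sum: "summable \<psi>"
    using summable_iff_shift[of \<psi> n] by (simp add: add.commute)
  have "(\<Sum>k. ennreal (\<psi> (n + k))) = ennreal (\<Sum>k. \<psi> (n + k))"
    by (rule suminf_ennreal2) (use \<psi>0 \<open>summable (\<lambda>k. \<psi> (n + k))\<close> in auto)
  moreover have "discrete_bound r f m (\<psi> m)" for m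
    unfolding discrete_bound_def
  proof (intro allI impI)
    fix i :: 'n and b assume b: "(\<forall>j. b j \<le> 2 ^ m) \<and> b i + r \<le> 2 ^ m"
    then have "ennreal \<bar>finite_diff r ((1 / 2 ^ m) *\<^sub>R axis i 1) f (grid_point m b)\<bar> \<le> ennreal (\<psi> m)"
      using discrete_modulus_ge[of b m i r f] by (simp add: \<psi>)
    then show "\<bar>finite_diff r ((1 / 2 ^ m) *\<^sub>R axis i 1) f (grid_point m b)\<bar> \<le> \<psi> m"
      using \<psi>0 by (simp add: ennreal_le_iff)
  qed
  ultimately show thesis
    using that[of \<psi>] \<psi>0 sum \<psi> shift by simp
qed

lemma pure_difference_abs:
  assumes "\<And>i t u. 0 \<le> t \<Longrightarrow> t \<le> T \<Longrightarrow> u \<in> unit_cube \<Longrightarrow> u + (real r * t) *\<^sub>R axis i 1 \<in> unit_cube \<Longrightarrow>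
      \<bar>finite_diff r (t *\<^sub>R axis i 1) f u\<bar> \<le> w"
    and "\<bar>\<tau>\<bar> \<le> T" "u \<in> unit_cube" "u + (real r * \<tau>) *\<^sub>R axis i 1 \<in> unit_cube"
  shows "\<bar>finite_diff r (\<tau> *\<^sub>R axis i 1) f u\<bar> \<le> w"
proof (cases "\<tau> \<ge> 0")
  case True
  then show ?thesis using assms by simp
next
  case False
  let ?u = "u + (real r * \<tau>) *\<^sub>R axis i 1"
  have "\<bar>finite_diff r ((- \<tau>) *\<^sub>R axis i 1) f ?u\<bar> \<le> w"
    by (rule assms(1)) (use assms False in auto)
  then show ?thesis
    using dif_funpow_reverse[where c = "\<tau> *\<^sub>R axis i 1" and r = r and g = f and x = u]
    by (simp add: finite_diff_eq_dif)
qed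

text \<open>In the sum on the left a term of index at least \<open>n\<close> has total weight at
  most 1 / (1 - q), hence at most 2, and a term of index \<open>j < n\<close> at most 2 q^(n-j).
  Induction on \<open>n\<close> avoids rearranging the double series.\<close>

lemma sum_geometric_tails:
  fixes \<psi> :: "nat \<Rightarrow> real"
  assumes \<psi>: "\<And>m. 0 \<le> \<psi> m" "summable \<psi>" and q: "0 \<le> q" "q \<le> 1 / 2"
  shows "(\<Sum>j\<le>n. q ^ (n - j) * (\<Sum>k. \<psi> (j + k)))
    \<le> 2 * (\<Sum>k. \<psi> (n + k)) + 2 * (\<Sum>j<n. q ^ (n - j) * \<psi> j)"
proof (induction n)
  case 0
  have "0 \<le> (\<Sum>k. \<psi> k)" using \<psi> by (intro suminf_nonneg) auto
  then show ?case by simp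
next
  case (Suc n)
  define T where "T j = (\<Sum>k. \<psi> (j + k))" for j
  have T0: "T j \<ge> 0" for j
    unfolding T_def using \<psi> summable_shift_nat by (intro suminf_nonneg) auto
  have T: "T n = T (Suc n) + \<psi> n"
    using suminf_split_head[OF summable_shift_nat[OF \<psi>(2), of n]] by (simp add: T_def)
  have Sq: "q ^ (Suc n - j) = q * q ^ (n - j)" if "j \<le> n" for j
    using that by (simp add: Suc_diff_le)
  have "(\<Sum>j\<le>Suc n. q ^ (Suc n - j) * T j) = q * (\<Sum>j\<le>n. q ^ (n - j) * T j) + T (Suc n)"
    by (simp add: sum_distrib_left Sq mult.assoc)
  also have "\<dots> \<le> q * (2 * T n + 2 * (\<Sum>j<n. q ^ (n - j) * \<psi> j)) + T (Suc n)"
    using Suc.IH q by (intro add_right_mono mult_left_mono) (auto simp: T_def)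
  also have "\<dots> = 2 * q * T (Suc n) + T (Suc n) + 2 * (q * \<psi> n + q * (\<Sum>j<n. q ^ (n - j) * \<psi> j))"
    unfolding T by (simp add: algebra_simps)
  also have "q * \<psi> n + q * (\<Sum>j<n. q ^ (n - j) * \<psi> j) = (\<Sum>j<Suc n. q ^ (Suc n - j) * \<psi> j)"
    by (simp add: sum_distrib_left Sq mult.assoc)
  also have "2 * q * T (Suc n) \<le> 1 * T (Suc n)"
    using q T0 by (intro mult_right_mono) auto
  finally show ?case unfolding T_def by simp
qed

text \<open>With \<open>k = n - j\<close> the weights agree. Indices beyond the cutoff contribute 0,
  and the cutoff may admit further indices, such as \<open>k = n + 1\<close> for
  \<open>r = 1\<close>, whose terms are nonnegative.\<close>

lemma coarse_sum_le:
  assumes "r \<ge> 1" and \<psi>: "\<And>m. 0 \<le> \<psi> m" "\<And>m. discrete_modulus r f (int m) = ennreal (\<psi> m)"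
  shows "ennreal (\<Sum>j<n. (1 / 2 ^ r) ^ (n - j) * \<psi> j)
    \<le> (\<Sum>k\<in>{1..level_cutoff r n}. ennreal (2 powi (- (k * int r))) * discrete_modulus r f (int n - k))"
proof -
  let ?g = "\<lambda>k. ennreal (2 powi (- (k * int r))) * discrete_modulus r f (int n - k)"
  have "ennreal (\<Sum>j<n. (1 / 2 ^ r) ^ (n - j) * \<psi> j) = (\<Sum>j<n. ennreal ((1 / 2 ^ r) ^ (n - j) * \<psi> j))"
    using \<psi> by (intro sum_ennreal[symmetric]) simp
  also have "\<dots> = (\<Sum>j<n. ?g (int n - int j))"
  proof (rule sum.cong[OF refl])
    fix j assume "j \<in> {..<n}"
    then have "int n - int j = int (n - j)" by auto
    then have "(2::real) powi (- ((int n - int j) * int r)) = inverse (2 ^ ((n - j) * r))"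
      by (simp only: power_int_minus of_nat_mult[symmetric] power_int_of_nat)
    also have "\<dots> = (1 / 2 ^ r) ^ (n - j)"
      by (simp add: power_divide power_mult[symmetric] mult.commute inverse_eq_divide)
    finally show "ennreal ((1 / 2 ^ r) ^ (n - j) * \<psi> j) = ?g (int n - int j)"
      using \<psi>(1)[of j] by (simp add: \<psi>(2) ennreal_mult)
  qed
  also have "\<dots> = (\<Sum>k\<in>(\<lambda>j. int n - int j) ` {..<n}. ?g k)"
    by (subst sum.reindex) (auto simp: inj_on_def)
  also have "\<dots> = (\<Sum>k\<in>(\<lambda>j. int n - int j) ` {..<n} \<inter> {1..level_cutoff r n}. ?g k)"
  proof (rule sum.mono_neutral_right)
    show "\<forall>k\<in>(\<lambda>j. int n - int j) ` {..<n} - (\<lambda>j. int n - int j) ` {..<n} \<inter> {1..level_cutoff r n}. ?g k = 0"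
    proof
      fix k assume k: "k \<in> (\<lambda>j. int n - int j) ` {..<n} - (\<lambda>j. int n - int j) ` {..<n} \<inter> {1..level_cutoff r n}"
      then have "\<not> k \<le> level_cutoff r n" by auto
      then have "real r * 2 powi (k - int n - 1) > 1"
        using level_cutoff_ge[OF \<open>r \<ge> 1\<close>, of k n] by linarith
      \<comment> \<open>Beyond the cutoff even half the length of \<open>r\<close> steps of level
        \<open>n - k\<close> exceeds 1, so the length itself does.\<close>
      also have "real r * 2 powi (k - int n - 1) \<le> real r * 2 powi (- (int n - k))"
        by (intro mult_left_mono power_int_increasing) auto
      finally show "?g k = 0" by (simp add: discrete_modulus_eq_0)
    qed
  qed auto
  also have "\<dots> \<le> (\<Sum>k\<in>{1..level_cutoff r n}. ?g k)"
    by (intro sum_mono2) auto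
  finally show ?thesis .
qed

section \<open>Estimates for the moduli of smoothness\<close>

lemma modulus_smoothness_le:
  assumes "\<And>h x. norm h \<le> t \<Longrightarrow> x \<in> unit_cube \<Longrightarrow> x + real r *\<^sub>R h \<in> unit_cube \<Longrightarrow>
    \<bar>finite_diff r h f x\<bar> \<le> B"
  shows "modulus_smoothness r f t \<le> ennreal B"
  unfolding modulus_smoothness_def using assms by (intro Sup_least) (auto intro!: ennreal_leI)

lemma ennreal_mult_top_pos: "0 < a \<Longrightarrow> ennreal a * top = top"
  by (simp add: ennreal_mult_eq_top_iff)

lemma modulus_smoothness_marchaud:
  fixes f :: "real ^ 'n \<Rightarrow> real"
  assumes "r \<ge> 1" and cont: "continuous_on unit_cube f"
    and pure: "\<And>\<psi> n i t u. (\<And>m. 0 \<le> \<psi> m) \<Longrightarrow> summable \<psi> \<Longrightarrow> (\<And>m. discrete_bound r f m (\<psi> m)) \<Longrightarrow>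
      0 \<le> t \<Longrightarrow> t \<le> 1 / 2 ^ n \<Longrightarrow> u \<in> unit_cube \<Longrightarrow> u + (real r * t) *\<^sub>R axis i 1 \<in> unit_cube \<Longrightarrow>
      \<bar>finite_diff r (t *\<^sub>R axis i 1) f u\<bar> \<le> M1 * (\<Sum>k. \<psi> (n + k))"
    and marchaud: "\<And>w F m. (\<And>m. w m \<ge> 0) \<Longrightarrow> F \<ge> 0 \<Longrightarrow> (\<And>x. x \<in> unit_cube \<Longrightarrow> \<bar>f x\<bar> \<le> F) \<Longrightarrow>
      (\<And>m i \<tau> u. \<bar>\<tau>\<bar> \<le> 1 / 2 ^ m \<Longrightarrow> u \<in> unit_cube \<Longrightarrow>
        u + (real r * \<tau>) *\<^sub>R axis i 1 \<in> unit_cube \<Longrightarrow> \<bar>finite_diff r (\<tau> *\<^sub>R axis i 1) f u\<bar> \<le> w m) \<Longrightarrow>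
      mixed_bounded r f r (1 / 2 ^ m) (C * marchaud_sum w F r m)"
    and "M1 > 0" "C \<ge> 0" and t: "1 / 2 ^ Suc n < t" "t \<le> 1 / 2 ^ n"
    and M2: "M2 = real CARD('n) ^ r * C * (2 * M1 + 2 ^ r) + 1"
  shows "modulus_smoothness r f t
      \<le> ennreal M2 *
         ((\<Sum>k. discrete_modulus r f (int n + int k))
          + (\<Sum>k\<in>{1..level_cutoff r n}.
               ennreal (2 powi (- (k * int r))) * discrete_modulus r f (int n - k))
          + ennreal (t ^ r) * cube_norm f)"
proof (cases "(\<Sum>k. discrete_modulus r f (int n + int k)) = \<infinity>")
  case True
  \<comment> \<open>The summand 1 keeps \<open>M2\<close> positive even if \<open>C = 0\<close>;
    otherwise the product with infinity would be 0.\<close>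
  have "M2 > 0" using assms by (simp add: add_nonneg_pos)
  then show ?thesis using True by (simp add: ennreal_mult_top_pos)
next
  case False
  obtain F where F: "F \<ge> 0" "\<And>x. x \<in> unit_cube \<Longrightarrow> \<bar>f x\<bar> \<le> F" "cube_norm f = ennreal F"
    using cube_norm_real[OF cont] by metis
  obtain \<psi> where \<psi>: "\<And>m. 0 \<le> \<psi> m" "summable \<psi>" "\<And>m. discrete_modulus r f (int m) = ennreal (\<psi> m)"
    "\<And>m. discrete_bound r f m (\<psi> m)"
    and sum: "(\<Sum>k. discrete_modulus r f (int n + int k)) = ennreal (\<Sum>k. \<psi> (n + k))"
    using discrete_modulus_real[OF F(2) False] by metis
  define q where "q = 1 / (2::real) ^ r"
  \<comment> \<open>The bound for pure differences is needed at every level up to \<open>n\<close>,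
    so tails starting before \<open>n\<close> enter; \<open>sum_geometric_tails\<close> later
    separates their coarse terms.\<close>
  define w where "w m = M1 * (\<Sum>k. \<psi> (m + k))" for m
  define T where "T = (\<Sum>k. \<psi> (n + k))"
  define P where "P = (\<Sum>j<n. q ^ (n - j) * \<psi> j)"
  have tails: "0 \<le> (\<Sum>k. \<psi> (m + k))" for m
    using \<psi>(1,2) summable_shift_nat by (intro suminf_nonneg) auto
  have w0: "w m \<ge> 0" for m
    using tails \<open>M1 > 0\<close> by (simp add: w_def)
  have TP: "T \<ge> 0" "P \<ge> 0"
    using tails \<psi>(1) by (auto simp: T_def P_def q_def intro!: sum_nonneg)
  have q: "0 \<le> q" "q \<le> 1 / 2"
    using power_increasing[of 1 r "2::real"] \<open>r \<ge> 1\<close> by (auto simp: q_def field_simps)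
  have "t > 0" using t(1) by (rule le_less_trans[rotated]) simp
  have bounded: "mixed_bounded r f r (1 / 2 ^ n) (C * marchaud_sum w F r n)"
  proof (rule marchaud[OF w0 F(1,2)])
    fix m i \<tau> and u :: "real ^ 'n"
    assume u: "\<bar>\<tau>\<bar> \<le> 1 / 2 ^ m" "u \<in> unit_cube" "u + (real r * \<tau>) *\<^sub>R axis i 1 \<in> unit_cube"
    show "\<bar>finite_diff r (\<tau> *\<^sub>R axis i 1) f u\<bar> \<le> w m"
      unfolding w_def by (rule pure_difference_abs[OF pure[OF \<psi>(1,2,4)] u])
  qed
  have "marchaud_sum w F r n = M1 * (\<Sum>j\<le>n. q ^ (n - j) * (\<Sum>k. \<psi> (j + k))) + q ^ n * F"
    by (simp add: marchaud_sum_def w_def q_def sum_distrib_left mult_ac)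
  also have "\<dots> \<le> M1 * (2 * T + 2 * P) + (2 ^ r * t ^ r) * F"
  proof (intro add_mono mult_left_mono mult_right_mono)
    show "(\<Sum>j\<le>n. q ^ (n - j) * (\<Sum>k. \<psi> (j + k))) \<le> 2 * T + 2 * P"
      unfolding T_def P_def by (rule sum_geometric_tails[OF \<psi>(1,2) q])
    \<comment> \<open>Here the lower bound on \<open>t\<close> is used: it turns the leftover factor
      \<open>q ^ n\<close>, that is 2^-nr, into a multiple of \<open>t ^ r\<close>.\<close>
    have "1 / 2 ^ n \<le> 2 * t" using t(1) by simp
    then have "(1 / 2 ^ n) ^ r \<le> (2 * t) ^ r" by (intro power_mono) auto
    then show "q ^ n \<le> 2 ^ r * t ^ r"
      by (simp add: q_def power_divide power_mult_distrib power_mult[symmetric] mult.commute)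
  qed (use F \<open>M1 > 0\<close> in auto)
  also have "\<dots> \<le> (2 * M1 + 2 ^ r) * (T + P + t ^ r * F)"
    using TP F(1) \<open>M1 > 0\<close> \<open>t > 0\<close> by (simp add: algebra_simps)
  finally have "marchaud_sum w F r n \<le> (2 * M1 + 2 ^ r) * (T + P + t ^ r * F)" .
  then have "real CARD('n) ^ r * C * marchaud_sum w F r n
      \<le> real CARD('n) ^ r * C * ((2 * M1 + 2 ^ r) * (T + P + t ^ r * F))"
    using \<open>C \<ge> 0\<close> by (intro mult_left_mono) auto
  also have "\<dots> \<le> M2 * (T + P + t ^ r * F)"
    using TP F(1) \<open>t > 0\<close> by (simp add: M2 distrib_right mult.assoc)
  finally have le: "real CARD('n) ^ r * (C * marchaud_sum w F r n) \<le> M2 * (T + P + t ^ r * F)"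
    by (simp add: mult.assoc)
  have "modulus_smoothness r f t \<le> ennreal (M2 * (T + P + t ^ r * F))"
  proof (rule modulus_smoothness_le)
    fix h x :: "real ^ 'n"
    assume x: "norm h \<le> t" "x \<in> unit_cube" "x + real r *\<^sub>R h \<in> unit_cube"
    then have "\<bar>finite_diff r h f x\<bar> \<le> real CARD('n) ^ r * (C * marchaud_sum w F r n)"
      using t by (intro finite_diff_mixed_bound[OF bounded]) auto
    then show "\<bar>finite_diff r h f x\<bar> \<le> M2 * (T + P + t ^ r * F)"
      using le by linarith
  qed
  also have "\<dots> = ennreal M2 * (ennreal T + ennreal P + ennreal (t ^ r) * ennreal F)"
    using TP F(1) \<open>t > 0\<close> \<open>M1 > 0\<close> \<open>C \<ge> 0\<close> by (simp add: ennreal_mult ennreal_plus M2)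
  also have "\<dots> \<le> ennreal M2 *
         ((\<Sum>k. discrete_modulus r f (int n + int k))
          + (\<Sum>k\<in>{1..level_cutoff r n}.
               ennreal (2 powi (- (k * int r))) * discrete_modulus r f (int n - k))
          + ennreal (t ^ r) * cube_norm f)"
    unfolding sum F(3) T_def P_def q_def
    by (intro mult_left_mono add_mono order.refl coarse_sum_le[OF \<open>r \<ge> 1\<close> \<psi>(1,3)]) auto
  finally show ?thesis .
qed

lemma modulus_continuity_bound:
  fixes f :: "real ^ 'n \<Rightarrow> real"
  assumes cont: "continuous_on unit_cube f"
    and pure: "\<And>\<psi> n i t u. (\<And>m. 0 \<le> \<psi> m) \<Longrightarrow> summable \<psi> \<Longrightarrow> (\<And>m. discrete_bound 1 f m (\<psi> m)) \<Longrightarrow>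
      0 \<le> t \<Longrightarrow> t \<le> 1 / 2 ^ n \<Longrightarrow> u \<in> unit_cube \<Longrightarrow> u + (real 1 * t) *\<^sub>R axis i 1 \<in> unit_cube \<Longrightarrow>
      \<bar>finite_diff 1 (t *\<^sub>R axis i 1) f u\<bar> \<le> C * (\<Sum>k. \<psi> (n + k))"
    and "C > 0" and t: "t \<le> 1 / 2 ^ n"
  shows "modulus_smoothness 1 f t
    \<le> ennreal (real CARD('n) * (2 * C)) * (\<Sum>k. discrete_modulus 1 f (int n + int k))"
proof (cases "(\<Sum>k. discrete_modulus 1 f (int n + int k)) = \<infinity>")
  case True
  then show ?thesis using \<open>C > 0\<close> by (simp add: ennreal_mult_top_pos)
next
  case False
  obtain F where F: "F \<ge> 0" "\<And>x. x \<in> unit_cube \<Longrightarrow> \<bar>f x\<bar> \<le> F" "cube_norm f = ennreal F"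
    using cube_norm_real[OF cont] by metis
  obtain \<psi> where \<psi>: "\<And>m. 0 \<le> \<psi> m" "summable \<psi>" "\<And>m. discrete_bound 1 f m (\<psi> m)"
    and sum: "(\<Sum>k. discrete_modulus 1 f (int n + int k)) = ennreal (\<Sum>k. \<psi> (n + k))"
    using discrete_modulus_real[OF F(2) False] by metis
  define T where "T = (\<Sum>k. \<psi> (n + k))"
  have T: "T \<ge> 0"
    unfolding T_def using \<psi>(1,2) summable_shift_nat by (intro suminf_nonneg) auto
  have bounded: "mixed_bounded 1 f 1 (1 / 2 ^ n) (2 * (C * T))"
  proof (rule mixed_bounded_one)
    fix i \<tau> and u :: "real ^ 'n"
    assume u: "\<bar>\<tau>\<bar> \<le> 1 / 2 ^ n" "u \<in> unit_cube" "u + \<tau> *\<^sub>R axis i 1 \<in> unit_cube"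
    show "\<bar>finite_diff 1 (\<tau> *\<^sub>R axis i 1) f u\<bar> \<le> C * T"
      unfolding T_def by (rule pure_difference_abs[OF pure[OF \<psi>] u(1,2)]) (use u(3) in simp_all)
  qed (use T \<open>C > 0\<close> in simp)
  have "modulus_smoothness 1 f t \<le> ennreal (real CARD('n) * (2 * C) * T)"
  proof (rule modulus_smoothness_le)
    fix h x :: "real ^ 'n"
    assume x: "norm h \<le> t" "x \<in> unit_cube" "x + real 1 *\<^sub>R h \<in> unit_cube"
    then have "\<bar>finite_diff 1 h f x\<bar> \<le> real CARD('n) ^ 1 * (2 * (C * T))"
      using t by (intro finite_diff_mixed_bound[OF bounded]) auto
    then show "\<bar>finite_diff 1 h f x\<bar> \<le> real CARD('n) * (2 * C) * T"
      by (simp add: mult.assoc)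
  qed
  also have "\<dots> = ennreal (real CARD('n) * (2 * C)) * (\<Sum>k. discrete_modulus 1 f (int n + int k))"
    unfolding sum T_def[symmetric] using T \<open>C > 0\<close> by (intro ennreal_mult) auto
  finally show ?thesis .
qed

theorem theorem1p1:
  "\<exists>M::real. M > 0 \<and> (\<forall>r::nat. r \<ge> 1 \<longrightarrow>
    (\<exists>(M1::real) (M2::real). M1 > 0 \<and> M2 > 0 \<and>
      (\<forall>(f :: real ^ 'n \<Rightarrow> real) (n::nat). continuous_on unit_cube f \<longrightarrow>
        (\<forall>(i::'n) (t::real) (u::real ^ 'n).
            0 \<le> t \<and> t \<le> 2 powi (- int n) \<and> u \<in> unit_cube \<and>
            u + (real r * t) *\<^sub>R axis i 1 \<in> unit_cube \<longrightarrow>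
            ennreal \<bar>finite_diff r (t *\<^sub>R axis i 1) f u\<bar>
              \<le> ennreal M1 * (\<Sum>k. discrete_modulus r f (int n + int k))) \<and>
        (\<forall>t::real. 2 powi (- int n - 1) < t \<and> t \<le> 2 powi (- int n) \<longrightarrow>
            modulus_smoothness r f t
              \<le> ennreal M2 *
                 ((\<Sum>k. discrete_modulus r f (int n + int k))
                  + (\<Sum>k\<in>{1..level_cutoff r n}.
                       ennreal (2 powi (- (k * int r))) * discrete_modulus r f (int n - k))
                  + ennreal (t ^ r) * cube_norm f)) \<and>
        (r = 1 \<longrightarrow>
          (\<forall>t::real. 0 \<le> t \<and> t \<le> 2 powi (- int n) \<longrightarrow>
            modulus_smoothness 1 f t
              \<le> ennreal M * (\<Sum>k. discrete_modulus 1 f (int n + int k)))))))"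
proof -
  have pow: "(2::real) powi (- int n) = 1 / 2 ^ n" for n
    by (simp add: power_int_minus field_simps)
  have pow1: "(2::real) powi (- int n - 1) = 1 / 2 ^ Suc n" for n
  proof -
    have "- int n - 1 = - int (Suc n)" by simp
    then show ?thesis by (simp only: pow)
  qed
  have pure_ex: "\<exists>C>0. \<forall>(f :: real ^ 'n \<Rightarrow> real). continuous_on unit_cube f \<longrightarrow>
      (\<forall>\<psi> n i t u. (\<forall>m. 0 \<le> \<psi> m) \<longrightarrow> summable \<psi> \<longrightarrow> (\<forall>m. discrete_bound r f m (\<psi> m)) \<longrightarrow>
        0 \<le> t \<longrightarrow> t \<le> 1 / 2 ^ n \<longrightarrow> u \<in> unit_cube \<longrightarrow>
        u + (real r * t) *\<^sub>R axis i 1 \<in> unit_cube \<longrightarrow>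
        \<bar>finite_diff r (t *\<^sub>R axis i 1) f u\<bar> \<le> C * (\<Sum>k. \<psi> (n + k)))" if r1: "r \<ge> 1" for r
  proof -
    obtain C where "C > 0" and C: "\<forall>(f :: real ^ 'n \<Rightarrow> real) \<psi> n i t u.
        continuous_on unit_cube f \<longrightarrow> (\<forall>m. 0 \<le> \<psi> m) \<longrightarrow> summable \<psi> \<longrightarrow>
        (\<forall>m>n. discrete_bound r f m (\<psi> m)) \<longrightarrow> 0 \<le> t \<longrightarrow> t \<le> 1 / 2 ^ n \<longrightarrow> u \<in> unit_cube \<longrightarrow>
        u + (real r * t) *\<^sub>R axis i 1 \<in> unit_cube \<longrightarrow>
        \<bar>finite_diff r (t *\<^sub>R axis i 1) f u\<bar> \<le> C * (\<Sum>k. \<psi> (n + k))"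
      using pure_difference_bound[OF r1] by blast
    show ?thesis
      by (intro exI[of _ C] conjI \<open>C > 0\<close> allI impI) (rule C[rule_format], simp_all)
  qed
  \<comment> \<open>The constant of (iii) comes from the case \<open>r = 1\<close> alone, so it is
    fixed before \<open>r\<close> and depends only on the dimension.\<close>
  obtain C1 where "C1 > 0" and C1: "\<forall>(f :: real ^ 'n \<Rightarrow> real). continuous_on unit_cube f \<longrightarrow>
      (\<forall>\<psi> n i t u. (\<forall>m. 0 \<le> \<psi> m) \<longrightarrow> summable \<psi> \<longrightarrow> (\<forall>m. discrete_bound 1 f m (\<psi> m)) \<longrightarrow>
        0 \<le> t \<longrightarrow> t \<le> 1 / 2 ^ n \<longrightarrow> u \<in> unit_cube \<longrightarrow>
        u + (real 1 * t) *\<^sub>R axis i 1 \<in> unit_cube \<longrightarrow>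
        \<bar>finite_diff 1 (t *\<^sub>R axis i 1) f u\<bar> \<le> C1 * (\<Sum>k. \<psi> (n + k)))"
    using pure_ex[of 1] by blast
  show ?thesis
  proof (rule exI[of _ "real CARD('n) * (2 * C1)"], intro conjI allI impI)
    show "0 < real CARD('n) * (2 * C1)" using \<open>C1 > 0\<close> by simp
    fix r :: nat assume r: "1 \<le> r"
    obtain M1 where "M1 > 0" and M1: "\<forall>(f :: real ^ 'n \<Rightarrow> real). continuous_on unit_cube f \<longrightarrow>
        (\<forall>\<psi> n i t u. (\<forall>m. 0 \<le> \<psi> m) \<longrightarrow> summable \<psi> \<longrightarrow> (\<forall>m. discrete_bound r f m (\<psi> m)) \<longrightarrow>
          0 \<le> t \<longrightarrow> t \<le> 1 / 2 ^ n \<longrightarrow> u \<in> unit_cube \<longrightarrow>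
          u + (real r * t) *\<^sub>R axis i 1 \<in> unit_cube \<longrightarrow>
          \<bar>finite_diff r (t *\<^sub>R axis i 1) f u\<bar> \<le> M1 * (\<Sum>k. \<psi> (n + k)))"
      using pure_ex[OF r] by blast
    \<comment> \<open>The order is taken equal to \<open>r\<close>, where a level that is
      \<open>k\<close> steps coarser has weight 2^-kr.\<close>
    obtain C where "C \<ge> 0" and C: "\<forall>(f :: real ^ 'n \<Rightarrow> real) w F m. (\<forall>m. w m \<ge> 0) \<longrightarrow> F \<ge> 0 \<longrightarrow>
        (\<forall>x\<in>unit_cube. \<bar>f x\<bar> \<le> F) \<longrightarrow>
        (\<forall>m i \<tau> u. \<bar>\<tau>\<bar> \<le> 1 / 2 ^ m \<longrightarrow> u \<in> unit_cube \<longrightarrow>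
          u + (real r * \<tau>) *\<^sub>R axis i 1 \<in> unit_cube \<longrightarrow> \<bar>finite_diff r (\<tau> *\<^sub>R axis i 1) f u\<bar> \<le> w m) \<longrightarrow>
        mixed_bounded r f r (1 / 2 ^ m) (C * marchaud_sum w F r m)"
      using mixed_bounded_marchaud[of r r] by blast
    define M2 where "M2 = real CARD('n) ^ r * C * (2 * M1 + 2 ^ r) + 1"
    show "\<exists>M1 M2. M1 > 0 \<and> M2 > 0 \<and>
      (\<forall>(f :: real ^ 'n \<Rightarrow> real) (n::nat). continuous_on unit_cube f \<longrightarrow>
        (\<forall>(i::'n) (t::real) (u::real ^ 'n).
            0 \<le> t \<and> t \<le> 2 powi (- int n) \<and> u \<in> unit_cube \<and>
            u + (real r * t) *\<^sub>R axis i 1 \<in> unit_cube \<longrightarrow>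
            ennreal \<bar>finite_diff r (t *\<^sub>R axis i 1) f u\<bar>
              \<le> ennreal M1 * (\<Sum>k. discrete_modulus r f (int n + int k))) \<and>
        (\<forall>t::real. 2 powi (- int n - 1) < t \<and> t \<le> 2 powi (- int n) \<longrightarrow>
            modulus_smoothness r f t
              \<le> ennreal M2 *
                 ((\<Sum>k. discrete_modulus r f (int n + int k))
                  + (\<Sum>k\<in>{1..level_cutoff r n}.
                       ennreal (2 powi (- (k * int r))) * discrete_modulus r f (int n - k))
                  + ennreal (t ^ r) * cube_norm f)) \<and>
        (r = 1 \<longrightarrow>
          (\<forall>t::real. 0 \<le> t \<and> t \<le> 2 powi (- int n) \<longrightarrow>
            modulus_smoothness 1 f t
              \<le> ennreal (real CARD('n) * (2 * C1)) * (\<Sum>k. discrete_modulus 1 f (int n + int k)))))"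
    proof (rule exI[of _ M1], rule exI[of _ M2], intro conjI allI impI; (elim conjE)?)
      show "M1 > 0" by fact
      show "M2 > 0"
        using \<open>M1 > 0\<close> \<open>C \<ge> 0\<close> by (simp add: M2_def add_nonneg_pos)
    next
      fix f :: "real ^ 'n \<Rightarrow> real" and n i and t :: real and u :: "real ^ 'n"
      assume cont: "continuous_on unit_cube f"
        and t: "0 \<le> t" "t \<le> 2 powi (- int n)" "u \<in> unit_cube" "u + (real r * t) *\<^sub>R axis i 1 \<in> unit_cube"
      show "ennreal \<bar>finite_diff r (t *\<^sub>R axis i 1) f u\<bar>
          \<le> ennreal M1 * (\<Sum>k. discrete_modulus r f (int n + int k))"
      proof (cases "(\<Sum>k. discrete_modulus r f (int n + int k)) = \<infinity>")
        case True
        then show ?thesis using \<open>M1 > 0\<close> by (simp add: ennreal_mult_top_pos)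
      next
        case False
        obtain F where F: "F \<ge> 0" "\<And>x. x \<in> unit_cube \<Longrightarrow> \<bar>f x\<bar> \<le> F" "cube_norm f = ennreal F"
          using cube_norm_real[OF cont] by metis
        obtain \<psi> where \<psi>: "\<And>m. 0 \<le> \<psi> m" "summable \<psi>" "\<And>m. discrete_bound r f m (\<psi> m)"
          and sum: "(\<Sum>k. discrete_modulus r f (int n + int k)) = ennreal (\<Sum>k. \<psi> (n + k))"
          using discrete_modulus_real[OF F(2) False] by metis
        have "\<bar>finite_diff r (t *\<^sub>R axis i 1) f u\<bar> \<le> M1 * (\<Sum>k. \<psi> (n + k))"
          using M1[THEN spec, THEN mp, OF cont, THEN spec[of _ \<psi>], THEN spec[of _ n], THEN spec[of _ i],
              THEN spec[of _ t], THEN spec[of _ u]] \<psi> t by (simp add: pow)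
        then show ?thesis
          unfolding sum using \<open>M1 > 0\<close> \<psi>(1,2) summable_shift_nat
          by (subst ennreal_mult[symmetric]) (auto intro!: ennreal_leI suminf_nonneg)
      qed
    next
      fix f :: "real ^ 'n \<Rightarrow> real" and n and t :: real
      assume cont: "continuous_on unit_cube f" and t: "2 powi (- int n - 1) < t" "t \<le> 2 powi (- int n)"
      show "modulus_smoothness r f t
          \<le> ennreal M2 *
             ((\<Sum>k. discrete_modulus r f (int n + int k))
              + (\<Sum>k\<in>{1..level_cutoff r n}.
                   ennreal (2 powi (- (k * int r))) * discrete_modulus r f (int n - k))
              + ennreal (t ^ r) * cube_norm f)"
      proof (rule modulus_smoothness_marchaud[OF r cont _ _ \<open>M1 > 0\<close> \<open>C \<ge> 0\<close> _ _ M2_def])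
        show "1 / 2 ^ Suc n < t" "t \<le> 1 / 2 ^ n" using t by (simp_all only: pow pow1)
        fix \<psi> n i and t :: real and u :: "real ^ 'n"
        assume "\<And>m. 0 \<le> \<psi> m" "summable \<psi>" "\<And>m. discrete_bound r f m (\<psi> m)" "0 \<le> t" "t \<le> 1 / 2 ^ n"
          "u \<in> unit_cube" "u + (real r * t) *\<^sub>R axis i 1 \<in> unit_cube"
        then show "\<bar>finite_diff r (t *\<^sub>R axis i 1) f u\<bar> \<le> M1 * (\<Sum>k. \<psi> (n + k))"
          using M1[THEN spec, THEN mp, OF cont, THEN spec[of _ \<psi>], THEN spec[of _ n], THEN spec[of _ i],
              THEN spec[of _ t], THEN spec[of _ u]] by simp
      next
        fix w F m
        assume "\<And>m. w m \<ge> 0" "F \<ge> 0" "\<And>x. x \<in> unit_cube \<Longrightarrow> \<bar>f x\<bar> \<le> F"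
          "\<And>m i \<tau> u. \<bar>\<tau>\<bar> \<le> 1 / 2 ^ m \<Longrightarrow> u \<in> unit_cube \<Longrightarrow>
            u + (real r * \<tau>) *\<^sub>R axis i 1 \<in> unit_cube \<Longrightarrow> \<bar>finite_diff r (\<tau> *\<^sub>R axis i 1) f u\<bar> \<le> w m"
        then show "mixed_bounded r f r (1 / 2 ^ m) (C * marchaud_sum w F r m)"
          using C[THEN spec[of _ f], THEN spec[of _ w], THEN spec[of _ F], THEN spec[of _ m]] by simp
      qed
    next
      fix f :: "real ^ 'n \<Rightarrow> real" and n and t :: real
      assume cont: "continuous_on unit_cube f" and t: "0 \<le> t" "t \<le> 2 powi (- int n)"
      show "modulus_smoothness 1 f t
          \<le> ennreal (real CARD('n) * (2 * C1)) * (\<Sum>k. discrete_modulus 1 f (int n + int k))"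
      proof (rule modulus_continuity_bound[OF cont _ \<open>C1 > 0\<close>])
        show "t \<le> 1 / 2 ^ n" using t by (simp only: pow)
        fix \<psi> n i and t :: real and u :: "real ^ 'n"
        assume "\<And>m. 0 \<le> \<psi> m" "summable \<psi>" "\<And>m. discrete_bound 1 f m (\<psi> m)" "0 \<le> t" "t \<le> 1 / 2 ^ n"
          "u \<in> unit_cube" "u + (real 1 * t) *\<^sub>R axis i 1 \<in> unit_cube"
        then show "\<bar>finite_diff 1 (t *\<^sub>R axis i 1) f u\<bar> \<le> C1 * (\<Sum>k. \<psi> (n + k))"
          using C1[THEN spec, THEN mp, OF cont, THEN spec[of _ \<psi>], THEN spec[of _ n], THEN spec[of _ i],
              THEN spec[of _ t], THEN spec[of _ u]] by simp
      qed
    qed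
  qed
qed

end
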